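(* For fixed integers $n,m,t$ with $n>m$ and $1\le t\le m-1$, as a function of the prime power $q$, $$\chi(J_q(n,m,t))=\Theta\left(q^{(m-t)\max(n-m,\,m)}\right).$$
   Context: For a prime power $q$ and integers $n>m$ and $1\le t\le m-1$, $J_q(n,m,t)$ is the graph whose vertices are the $m$-dimensional subspaces of $\mathbb{F}_q^n$, with two distinct vertices adjacent if and only if their intersection has dimension at least $t$. $\chi$ denotes the chromatic number.
   Formalization: The formal theorem adds the hypothesis n ≥ 2m − t; for n < 2m − t the graph is complete and its chromatic number is Θ(q^{m(n−m)}), so the stated formula fails for all such n, m, t (e.g. n=4, m=3, t=1: order q^3, not q^6). *)

theory Defs
  imports
    "Graph_Theory.Pair_Digraph"
    "Jordan_Normal_Form.Missing_VectorSpace"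
    "HOL-Number_Theory.Prime_Powers"
    "HOL-Library.Landau_Symbols"
begin

definition proper_coloring :: "'v pair_pre_digraph \<Rightarrow> nat \<Rightarrow> ('v \<Rightarrow> nat) \<Rightarrow> bool" where
  "proper_coloring G k c \<longleftrightarrow>
     c \<in> pverts G \<rightarrow> {..<k} \<and> (\<forall>(u, v) \<in> parcs G. c u \<noteq> c v)"

definition chromatic_number :: "'v pair_pre_digraph \<Rightarrow> nat" where
  "chromatic_number G = (LEAST k. \<exists>c. proper_coloring G k c)"

text \<open>The coordinate space \<open>K\<^sup>n\<close>: functions from \<open>{0..<n}\<close> to the carrier of \<open>K\<close>, extensional
  outside \<open>{0..<n}\<close>.\<close>

definition coord_space :: "'a ring \<Rightarrow> nat \<Rightarrow> ('a, nat \<Rightarrow> 'a) module" where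
  "coord_space K n = ring.func_space K {0..<n}"

definition subspace_dim :: "'a ring \<Rightarrow> nat \<Rightarrow> (nat \<Rightarrow> 'a) set \<Rightarrow> nat" where
  "subspace_dim K n W = vectorspace.dim K ((coord_space K n)\<lparr>carrier := W\<rparr>)"

definition subspaces_of_dim :: "'a ring \<Rightarrow> nat \<Rightarrow> nat \<Rightarrow> (nat \<Rightarrow> 'a) set set" where
  "subspaces_of_dim K n m = {W. subspace K W (coord_space K n) \<and> subspace_dim K n W = m}"

text \<open>The graph \<open>J\<^sub>q(n,m,t)\<close>, where \<open>K\<close> is the field with \<open>q\<close> elements; an undirected edge is
  represented by its two orientations. For \<open>n < 2 * m - t\<close> (over the integers) any two vertices
  meet in dimension at least \<open>2 * m - n > t\<close>, so the graph is complete.\<close>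

definition J_graph :: "'a ring \<Rightarrow> nat \<Rightarrow> nat \<Rightarrow> nat \<Rightarrow> (nat \<Rightarrow> 'a) set pair_pre_digraph" where
  "J_graph K n m t =
     \<lparr> pverts = subspaces_of_dim K n m,
       parcs = {(U, W). U \<in> subspaces_of_dim K n m \<and> W \<in> subspaces_of_dim K n m \<and>
                        U \<noteq> W \<and> t \<le> subspace_dim K n (U \<inter> W)} \<rparr>"

end

theory Submission
  imports Defs "HOL-Algebra.Algebraic_Closure"
begin

text \<open>
  Put \<open>d = m - t\<close> and \<open>N = max (n - m) m\<close>; the chromatic number lies between \<open>q ^ (d * N)\<close> and
  \<open>2 ^ n * q ^ (d * N)\<close>.

  Lower bound: the graphs of the linear maps \<open>K\<^sup>m \<rightarrow> K\<^sup>n\<^sup>-\<^sup>m\<close> that vanish on \<open>K\<^sup>t\<close> are pairwise adjacent,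
  as they share that \<open>K\<^sup>t\<close>; so are the graphs of the linear maps \<open>K\<^sup>m \<rightarrow> K\<^sup>m\<^sup>-\<^sup>t\<close>, as they lie in a space
  of dimension \<open>2m - t\<close>.

  Upper bound: every vertex is the graph of a linear map over some set \<open>P\<close> of \<open>m\<close> coordinates, that is,
  an \<open>m \<times> (n - m)\<close> matrix, and two vertices with the same \<open>P\<close> are adjacent iff their matrices differ
  by a matrix of rank at most \<open>d\<close>. The colour of a vertex consists of \<open>P\<close> and of the syndrome of its
  matrix for a Gabidulin code of minimum rank distance \<open>d + 1\<close>, which takes \<open>q ^ (d * N)\<close> values.
\<close>

section \<open>Frobenius maps and finite extensions\<close>

text \<open>The two bounds meet because a syndrome consists of \<open>d\<close> elements of an
  extension field whose degree is only the longer side of the matrix. A basis of that field over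
  \<open>K\<close> turns each line along the longer side into one field element; the shorter side
  indexes the evaluation points of the code, which must be independent over \<open>K\<close> and so
  cannot outnumber the degree. The extension is found inside the algebraic closure, as the fixed
  points of a power of Frobenius. Neither matrix rank nor field degree is formalised: rank at most
  \<open>d\<close> becomes a factorisation through \<open>d\<close> indices, and dimensions are read
  off from cardinalities. The hypothesis \<open>2 * m \<le> n + t\<close> says that a space of
  dimension \<open>2 * m - t\<close> fits into \<open>K^n\<close>. If it fails, any two vertices are
  adjacent and there are about \<open>q ^ (m * (n - m))\<close> of them; as
  \<open>m * (n - m) < m * (m - t)\<close>, the stated exponent would be too large.\<close>

lemma (in abelian_monoid) finsum_swap:
  assumes "finite A" "finite B" "\<And>x y. x \<in> A \<Longrightarrow> y \<in> B \<Longrightarrow> f x y \<in> carrier G"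
  shows "(\<Oplus>x\<in>A. \<Oplus>y\<in>B. f x y) = (\<Oplus>y\<in>B. \<Oplus>x\<in>A. f x y)"
  using assms(1,3)
proof (induction A rule: finite_induct)
  case empty
  then show ?case by simp
next
  case (insert a A)
  have "(\<Oplus>y\<in>B. \<Oplus>x\<in>insert a A. f x y) = (\<Oplus>y\<in>B. f a y \<oplus> (\<Oplus>x\<in>A. f x y))"
    by (rule finsum_cong') (use insert in \<open>auto intro!: finsum_closed simp: Pi_iff\<close>)
  also have "\<dots> = (\<Oplus>y\<in>B. f a y) \<oplus> (\<Oplus>y\<in>B. \<Oplus>x\<in>A. f x y)"
    by (rule finsum_addf) (use insert in \<open>auto intro!: finsum_closed simp: Pi_iff\<close>)
  finally show ?case
    using insert by (subst finsum_insert) (auto intro!: finsum_closed)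
qed

lemma (in cring) binomial:
  fixes n :: nat
  assumes x: "x \<in> carrier R" and y: "y \<in> carrier R"
  shows "(x \<oplus> y) [^] n = (\<Oplus>k\<in>{..n}. add_pow R (n choose k) (x [^] k \<otimes> y [^] (n - k)))"
proof (induction n)
  case 0
  then show ?case using x y by simp
next
  case (Suc n)
  let ?t = "\<lambda>k. x [^] k \<otimes> y [^] (Suc n - k)"
  have t: "?t k \<in> carrier R" for k using x y by simp
  have 1: "x \<otimes> (\<Oplus>k\<in>{..n}. add_pow R (n choose k) (x [^] k \<otimes> y [^] (n - k)))
      = (\<Oplus>k\<in>{..n}. add_pow R (n choose k) (?t (Suc k)))"
    using x y
    by (subst finsum_rdistr) (auto intro!: finsum_cong' simp: add_pow_rdistr m_ac)
  have 2: "y \<otimes> (\<Oplus>k\<in>{..n}. add_pow R (n choose k) (x [^] k \<otimes> y [^] (n - k)))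
      = (\<Oplus>k\<in>{..n}. add_pow R (n choose k) (?t k))"
    using x y
    by (subst finsum_rdistr) (auto intro!: finsum_cong' simp: add_pow_rdistr m_ac Suc_diff_le)
  \<comment> \<open>Since \<open>n choose Suc n = 0\<close>, the range may be extended by one; after
    splitting off \<open>k = 0\<close>, both sums run over \<open>?t (Suc k)\<close> and Pascal's
    rule merges them.\<close>
  have 3: "(\<Oplus>k\<in>{..n}. add_pow R (n choose k) (?t k)) = (\<Oplus>k\<in>{..Suc n}. add_pow R (n choose k) (?t k))"
    using t by (simp add: binomial_eq_0)
  have 4: "(\<Oplus>k\<in>{..Suc n}. add_pow R (n choose k) (?t k))
      = (\<Oplus>k\<in>{..n}. add_pow R (n choose Suc k) (?t (Suc k))) \<oplus> ?t 0"
    using t x y by (subst finsum_Suc2) auto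
  have "(x \<oplus> y) [^] Suc n
      = (\<Oplus>k\<in>{..n}. add_pow R (n choose k) (?t (Suc k))) \<oplus> ((\<Oplus>k\<in>{..n}. add_pow R (n choose Suc k) (?t (Suc k))) \<oplus> ?t 0)"
  proof -
    let ?S = "\<Oplus>k\<in>{..n}. add_pow R (n choose k) (x [^] k \<otimes> y [^] (n - k))"
    have S: "?S \<in> carrier R" using x y by (auto intro!: finsum_closed)
    have "(x \<oplus> y) [^] Suc n = (x \<oplus> y) \<otimes> ?S"
      unfolding nat_pow_Suc Suc.IH using S x y by (intro m_comm) auto
    also have "\<dots> = x \<otimes> ?S \<oplus> y \<otimes> ?S" by (rule l_distr[OF x y S])
    finally show ?thesis unfolding 1 2 3 4 .
  qed
  also have "\<dots> = (\<Oplus>k\<in>{..n}. add_pow R (Suc n choose Suc k) (?t (Suc k))) \<oplus> ?t 0"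
    using t x y by (simp add: a_assoc[symmetric] finsum_addf[symmetric] add.nat_pow_mult
        del: nat_pow_Suc diff_Suc_Suc)
  also have "\<dots> = (\<Oplus>k\<in>{..Suc n}. add_pow R (Suc n choose k) (?t k))"
    using t x y by (subst finsum_Suc2) auto
  finally show ?case .
qed

text \<open>The prime \<open>p\<close> divides every inner binomial coefficient. Stated for
  commutative rings because it is applied both to a field and to its polynomial ring.\<close>

lemma (in cring) freshmans_dream:
  fixes p k :: nat
  assumes p: "Factorial_Ring.prime p" and char: "add_pow R p \<one> = \<zero>" and x: "x \<in> carrier R" and y: "y \<in> carrier R"
  shows "(x \<oplus> y) [^] (p ^ k) = x [^] (p ^ k) \<oplus> y [^] (p ^ k)"
proof -
  have kill: "add_pow R (p * j) z = \<zero>" if "z \<in> carrier R" for j z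
    using that char add_pow_ldistr[of \<one> z p] add.nat_pow_one[of j]
    by (simp add: add.nat_pow_pow[symmetric])
  have base: "(u \<oplus> v) [^] p = u [^] p \<oplus> v [^] p" if u: "u \<in> carrier R" and v: "v \<in> carrier R" for u v
  proof -
    obtain r where r: "p = Suc r" using prime_gt_0_nat[OF p] gr0_implies_Suc by blast
    let ?t = "\<lambda>k. add_pow R (p choose k) (u [^] k \<otimes> v [^] (p - k))"
    have z: "?t k = \<zero>" if k: "0 < k" "k < p" for k
    proof -
      have "p dvd (p choose k)" using p k by (intro dvd_choose_prime) auto
      then obtain j where "p choose k = p * j" ..
      then show ?thesis using kill u v by simp
    qed
    have "(u \<oplus> v) [^] p = (\<Oplus>k\<in>{..p}. ?t k)" by (rule binomial[OF u v])
    also have "\<dots> = (\<Oplus>k\<in>{0,p}. ?t k)"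
      by (rule add.finprod_mono_neutral_cong_right) (use z u v in auto)
    also have "\<dots> = u [^] p \<oplus> v [^] p"
      using u v r by (subst finsum_insert) (auto simp: a_comm)
    finally show ?thesis .
  qed
  show ?thesis
  proof (induction k)
    case 0
    then show ?case using x y by simp
  next
    case (Suc k)
    then show ?case using x y base
      by (simp add: nat_pow_pow[symmetric] mult.commute[of p])
  qed
qed

lemma (in cring) frobenius_hom:
  fixes p k :: nat
  assumes p: "Factorial_Ring.prime p" and char: "add_pow R p \<one> = \<zero>"
  shows "(\<lambda>x. x [^] (p ^ k)) \<in> ring_hom R R"
  using freshmans_dream[OF p char] by (intro ring_hom_memI) (auto simp: nat_pow_distrib)


lemma (in abelian_group) add_right_cancel_minus:
  assumes "x \<in> carrier G" "y \<in> carrier G" "z \<in> carrier G"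
  shows "(x \<oplus> z) \<ominus> (y \<oplus> z) = x \<ominus> y"
proof -
  have "(x \<oplus> z) \<ominus> (y \<oplus> z) = x \<oplus> (\<ominus> y \<oplus> (z \<oplus> \<ominus> z))"
    using assms by (simp add: a_minus_def minus_add a_ac)
  then show ?thesis using assms by (simp add: r_neg a_minus_def)
qed

text \<open>With \<open>Q = p ^ k\<close>, a root \<open>a\<close> of \<open>X\<^sup>Q - X\<close> is simple because \<open>X\<^sup>Q - X = (X - a)\<^sup>Q - (X - a)\<close>.\<close>

lemma (in algebraically_closed) card_frobenius_fixed:
  fixes p k :: nat
  assumes p: "Factorial_Ring.prime p" and char: "add_pow L p \<one> = \<zero>" and k: "k > 0"
  shows "finite {x \<in> carrier L. x [^] (p ^ k) = x}" "card {x \<in> carrier L. x [^] (p ^ k) = x} = p ^ k"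
proof -
  let ?Q = "p ^ k" and ?PR = "poly_ring L"
  have Q: "?Q > 1" using p k by (metis one_less_power prime_gt_1_nat)
  interpret UP: domain ?PR by (rule univ_poly_is_domain[OF carrier_is_subring])
  interpret C: ring_hom_ring L ?PR poly_of_const
    by (rule canonical_embedding_ring_hom[OF carrier_is_subring, simplified])
  have charP: "add_pow ?PR p \<one>\<^bsub>?PR\<^esub> = \<zero>\<^bsub>?PR\<^esub>"
  proof -
    have "poly_of_const (add_pow L j \<one>) = add_pow ?PR j \<one>\<^bsub>?PR\<^esub>" for j :: nat
      by (induction j) auto
    then show ?thesis using char by (metis C.hom_zero)
  qed
  have X: "X \<in> carrier ?PR" by (rule var_closed[OF carrier_is_subring])
  define P where "P = X [^]\<^bsub>?PR\<^esub> ?Q \<ominus>\<^bsub>?PR\<^esub> X"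
  have P: "P \<in> carrier ?PR" unfolding P_def using X by simp
  have degP: "degree P = ?Q"
  proof -
    have m: "X [^]\<^bsub>?PR\<^esub> ?Q = monom \<one> ?Q" by (rule unitary_monom_eq_var_pow[OF carrier_is_subring, symmetric])
    have "degree (\<ominus>\<^bsub>?PR\<^esub> X) = 1"
      using univ_poly_a_inv_degree[OF carrier_is_subring X] by (simp add: var_def)
    moreover have "degree (X [^]\<^bsub>?PR\<^esub> ?Q) = ?Q" unfolding m by (simp add: monom_def)
    moreover have "degree P = max (degree (X [^]\<^bsub>?PR\<^esub> ?Q)) (degree (\<ominus>\<^bsub>?PR\<^esub> X))"
      unfolding P_def a_minus_def univ_poly_add
      by (rule poly_add_degree_eq[OF carrier_is_subring]) (use calculation Q X k in \<open>auto simp: univ_poly_carrier\<close>)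
    ultimately show ?thesis using Q by linarith
  qed
  have P0: "P \<noteq> []" using degP Q by (metis list.size(3) diff_0_eq_0 not_one_less_zero)
  have evP: "eval P a = a [^] ?Q \<ominus> a" if a: "a \<in> carrier L" for a
  proof -
    interpret E: ring_hom_ring ?PR L "\<lambda>f. eval f a"
      by (rule eval_ring_hom[OF carrier_is_subring a])
    show ?thesis
      unfolding P_def using E.hom_nat_pow[OF X, of ?Q] eval_var[OF a] a X
      by (simp add: a_minus_def)
  qed
  have root: "a \<in># roots P \<longleftrightarrow> a \<in> carrier L \<and> a [^] ?Q = a" for a
    unfolding roots_mem_iff_is_root[OF P] is_root_def using P0 evP by auto
  have simple: "count (roots P) a = 1" if a: "a \<in># roots P" for a
  proof -
    have aL: "a \<in> carrier L" and aQ: "a [^] ?Q = a" using a root by auto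
    interpret E: ring_hom_ring ?PR L "\<lambda>f. eval f a"
      by (rule eval_ring_hom[OF carrier_is_subring aL])
    let ?Y = "[\<one>, \<ominus> a]" and ?c = "poly_of_const (\<ominus> a)"
    have c: "?c \<in> carrier ?PR" using aL by simp
    have Y: "?Y = X \<oplus>\<^bsub>?PR\<^esub> ?c"
      unfolding univ_poly_add var_def poly_of_const_def using aL by auto
    have Yc: "?Y \<in> carrier ?PR" unfolding Y using X c by simp
    interpret S: ring_hom_ring L L "\<lambda>x. x [^] ?Q"
      by (rule ring_hom_ringI2[OF ring_axioms ring_axioms frobenius_hom[OF p char]])
    \<comment> \<open>The root \<open>a\<close> is fixed by Frobenius, hence so is
      \<open>\<ominus> a\<close>; that the map commutes with negation avoids a case distinction on
      the parity of \<open>p\<close>.\<close>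
    have "?c [^]\<^bsub>?PR\<^esub> ?Q = ?c"
      using C.hom_nat_pow[of "\<ominus> a" ?Q] S.hom_a_inv[OF aL] aL aQ by simp
    then have YQ: "?Y [^]\<^bsub>?PR\<^esub> ?Q = X [^]\<^bsub>?PR\<^esub> ?Q \<oplus>\<^bsub>?PR\<^esub> ?c"
      unfolding Y using UP.freshmans_dream[OF p charP X c] by simp
    have PY: "P = ?Y [^]\<^bsub>?PR\<^esub> ?Q \<ominus>\<^bsub>?PR\<^esub> ?Y"
      unfolding YQ unfolding Y P_def using X c
      by (simp add: UP.add_right_cancel_minus)
    have "alg_mult P a \<le> 1"
    proof (rule ccontr)
      assume "\<not> ?thesis"
      then have "(?Y [^]\<^bsub>?PR\<^esub> (2::nat)) pdivides P"
        by (intro le_alg_mult_imp_pdivides[OF aL P]) auto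
      then obtain g where g: "g \<in> carrier ?PR" and Pg: "P = ?Y [^]\<^bsub>?PR\<^esub> (2::nat) \<otimes>\<^bsub>?PR\<^esub> g"
        unfolding pdivides_def factor_def by auto
      obtain r where r: "?Q = Suc r" "r > 0" using Q by (metis Suc_lessE One_nat_def)
      \<comment> \<open>One factor \<open>X - a\<close> is cancelled from
        \<open>(X - a)^2 * g = (X - a)^?Q - (X - a)\<close>, where \<open>?Q = Suc r\<close>.
        Evaluating the rest at \<open>a\<close> gives \<open>0 = -1\<close>, since
        \<open>r > 0\<close> makes the power vanish.\<close>
      have "?Y \<otimes>\<^bsub>?PR\<^esub> (?Y \<otimes>\<^bsub>?PR\<^esub> g) = ?Y \<otimes>\<^bsub>?PR\<^esub> (?Y [^]\<^bsub>?PR\<^esub> r \<ominus>\<^bsub>?PR\<^esub> \<one>\<^bsub>?PR\<^esub>)"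
        using Pg[unfolded PY r] Yc g
        by (simp add: a_minus_def UP.r_distr UP.r_minus UP.m_ac numeral_2_eq_2)
      then have "?Y \<otimes>\<^bsub>?PR\<^esub> g = ?Y [^]\<^bsub>?PR\<^esub> r \<ominus>\<^bsub>?PR\<^esub> \<one>\<^bsub>?PR\<^esub>"
        using UP.m_lcancel[of ?Y] Yc g by (simp add: univ_poly_zero)
      then have "eval (?Y \<otimes>\<^bsub>?PR\<^esub> g) a = eval (?Y [^]\<^bsub>?PR\<^esub> r \<ominus>\<^bsub>?PR\<^esub> \<one>\<^bsub>?PR\<^esub>) a" by simp
      moreover have "eval ?Y a = \<zero>" using aL by (simp add: r_neg)
      ultimately have "\<zero> = \<ominus> \<one>"
        using E.hom_nat_pow[OF Yc, of r] r(2) Yc g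
        by (simp add: a_minus_def nat_pow_zero del: eval.simps)
      then show False using neg_1_not_0 by metis
    qed
    moreover have "count (roots P) a > 0" using a by simp
    ultimately show ?thesis unfolding alg_mult_eq_count_roots[OF P] by linarith
  qed
  have set: "{x \<in> carrier L. x [^] ?Q = x} = set_mset (roots P)"
    using root by auto
  show "finite {x \<in> carrier L. x [^] ?Q = x}" unfolding set by (rule finite_set_mset)
  have "card (set_mset (roots P)) = size (roots P)"
  proof -
    have "(\<Sum>x\<in>set_mset (roots P). count (roots P) x) = (\<Sum>x\<in>set_mset (roots P). 1)"
      by (rule sum.cong, rule refl, rule simple)
    then show ?thesis unfolding size_multiset_overloaded_eq by (simp only: card_eq_sum)
  qed
  also have "\<dots> = ?Q" using roots_over_carrier[OF P] degP unfolding splitted_def by (rule trans)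
  finally show "card {x \<in> carrier L. x [^] ?Q = x} = ?Q" unfolding set .
qed

lemma (in domain) nat_pow_eq_zero:
  fixes n :: nat
  assumes "x \<in> carrier R" "x [^] n = \<zero>"
  shows "x = \<zero>"
  using assms by (induction n) (auto simp: integral_iff)

text \<open>By Lagrange, \<open>p ^ e\<close> copies of \<open>\<one>\<close> add up to zero. They
  also add up to the \<open>e\<close>-th power of the sum of \<open>p\<close> copies, and a domain
  has no nilpotent elements other than zero.\<close>

lemma (in domain) char_of_prime_power_order:
  fixes p e :: nat
  assumes "order R = p ^ e"
  shows "add_pow R p \<one> = \<zero>"
proof -
  have "add_pow R (p ^ k) \<one> = add_pow R p \<one> [^] k" for k
  proof (induction k)
    case (Suc k)
    then show ?case
      using add_pow_ldistr[of \<one> "add_pow R p \<one>" "p ^ k"]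
      by (simp add: add.nat_pow_pow[symmetric] mult.commute)
  qed simp
  moreover have "add_pow R (order R) \<one> = \<zero>"
    using add.pow_order_eq_1[of \<one>] by (simp add: order_def)
  ultimately show ?thesis using nat_pow_eq_zero assms by auto
qed

lemma (in field) pow_order_eq_self:
  assumes fin: "finite (carrier R)" and x: "x \<in> carrier R"
  shows "x [^] order R = x"
proof (cases "x = \<zero>")
  case True
  have "order R \<noteq> 0" using fin zero_closed by (auto simp: order_def)
  then show ?thesis using True by (simp add: nat_pow_zero)
next
  case False
  interpret M: group "Multiplicative_Group.mult_of R" by (rule field_mult_group)
  have "x [^] (order R - 1) = \<one>"
    using M.pow_order_eq_1[of x] False x order_mult_of[OF fin]
    by (simp add: Multiplicative_Group.nat_pow_mult_of)
  moreover have "order R = Suc (order R - 1)" using fin zero_closed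
    by (metis Suc_pred' card_gt_0_iff empty_iff order_def)
  ultimately show ?thesis using x by (metis nat_pow_Suc l_one)
qed

text \<open>All finite extensions of \<open>R\<close> are taken inside one field \<open>L\<close>,
  the algebraic closure: the fixed points of \<open>x \<mapsto> x ^ (q ^ r)\<close> are its subfield
  with \<open>q ^ r\<close> elements. This replaces a construction from irreducible polynomials,
  whose existence would have to be proved in every degree. Only the embedding, the Frobenius maps
  and the sizes of their fixed sets are exported.\<close>

lemma (in field) frobenius_extension:
  assumes q: "primepow q" and ord: "order R = q"
  obtains L :: "(('a list \<times> nat) multiset \<Rightarrow> 'a) ring" and \<iota>
  where "field L" "\<iota> \<in> ring_hom R L" "\<And>r. (\<lambda>x. x [^]\<^bsub>L\<^esub> (q ^ r)) \<in> ring_hom L L"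
    "\<And>x. x \<in> carrier R \<Longrightarrow> \<iota> x [^]\<^bsub>L\<^esub> q = \<iota> x"
    "\<And>r. r > 0 \<Longrightarrow> finite {x \<in> carrier L. x [^]\<^bsub>L\<^esub> (q ^ r) = x}"
    "\<And>r. r > 0 \<Longrightarrow> card {x \<in> carrier L. x [^]\<^bsub>L\<^esub> (q ^ r) = x} = q ^ r"
proof -
  obtain p e where p: "Factorial_Ring.prime p" "e > 0" "q = p ^ e"
    using q unfolding primepow_def by auto
  interpret L: algebraic_closure alg_closure "indexed_const ` carrier R" by (rule alg_closureE)
  interpret h: ring_hom_ring R alg_closure indexed_const
    by (rule ring_hom_ringI2[OF ring_axioms L.ring_axioms alg_closureE(2)])
  have fin: "finite (carrier R)" using q ord primepow_gt_0_nat[OF q] by (auto simp: order_def card_gt_0_iff)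
  have "indexed_const (add_pow R j \<one>) = add_pow alg_closure j \<one>\<^bsub>alg_closure\<^esub>" for j :: nat
    by (induction j) auto
  then have char: "add_pow alg_closure p \<one>\<^bsub>alg_closure\<^esub> = \<zero>\<^bsub>alg_closure\<^esub>"
    using char_of_prime_power_order[of p e] ord p by (metis h.hom_zero)
  have pow: "q ^ r = p ^ (e * r)" for r using p by (simp add: power_mult)
  show thesis
  proof
    show "field alg_closure" by (rule L.field_axioms)
    show "indexed_const \<in> ring_hom R alg_closure" by (rule alg_closureE)
    show "(\<lambda>x. x [^]\<^bsub>alg_closure\<^esub> (q ^ r)) \<in> ring_hom alg_closure alg_closure" for r
      unfolding pow by (rule L.frobenius_hom[OF p(1) char])
    show "indexed_const x [^]\<^bsub>alg_closure\<^esub> q = indexed_const x" if "x \<in> carrier R" for x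
      using h.hom_nat_pow[OF that, of q] pow_order_eq_self[OF fin that] ord by simp
    fix r :: nat assume "r > 0"
    then have "e * r > 0" using p by simp
    from L.card_frobenius_fixed[OF p(1) char this]
    show "finite {x \<in> carrier alg_closure. x [^]\<^bsub>alg_closure\<^esub> (q ^ r) = x}"
      "card {x \<in> carrier alg_closure. x [^]\<^bsub>alg_closure\<^esub> (q ^ r) = x} = q ^ r"
      unfolding pow by auto
  qed
qed

section \<open>Families independent over a subfield\<close>

definition indep_over :: "('b, 'c) ring_scheme \<Rightarrow> 'b set \<Rightarrow> 'i set \<Rightarrow> ('i \<Rightarrow> 'b) \<Rightarrow> bool" where
  "indep_over L F I h \<longleftrightarrow> (\<forall>x \<in> I \<rightarrow> F. (\<Oplus>\<^bsub>L\<^esub>i\<in>I. x i \<otimes>\<^bsub>L\<^esub> h i) = \<zero>\<^bsub>L\<^esub> \<longrightarrow> (\<forall>i\<in>I. x i = \<zero>\<^bsub>L\<^esub>))"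

text \<open>Counting replaces dimension theory: the combinations of the vectors chosen so far number
  at most \<open>card F ^ card J\<close>, which stays below \<open>card V\<close> while another
  index remains, so some element of \<open>V\<close> avoids them all.\<close>

lemma (in field) exists_indep_over:
  assumes F: "subfield F R" and finF: "finite F" and "finite J"
    and V: "V \<subseteq> carrier R" "finite V" "card F ^ card J \<le> card V"
  shows "\<exists>b \<in> J \<rightarrow> V. indep_over R F J b"
  using \<open>finite J\<close> V(3)
proof (induction J rule: finite_induct)
  case empty
  then show ?case by (auto simp: indep_over_def)
next
  case (insert j J)
  have FR: "F \<subseteq> carrier R" using subfieldE(3)[OF F] .
  have "{\<zero>, \<one>} \<subseteq> F" using subringE(2,3)[OF subfieldE(1)[OF F]] by simp
  then have "card F \<ge> 2" using card_mono[OF finF, of "{\<zero>, \<one>}"] by simp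
  then have "card F ^ card J < card F ^ Suc (card J)" by simp
  then have lt: "card F ^ card J < card V"
    by (rule less_le_trans) (use insert in simp)
  then obtain b where b: "b \<in> J \<rightarrow> V" "indep_over R F J b" using insert.IH by auto
  have bR: "b \<in> J \<rightarrow> carrier R" using b V by auto
  let ?S = "(\<lambda>x. \<Oplus>i\<in>J. x i \<otimes> b i) ` (J \<rightarrow>\<^sub>E F)"
  have "card ?S \<le> card F ^ card J"
    using card_image_le[of "J \<rightarrow>\<^sub>E F"] finF insert by (simp add: card_PiE finite_PiE)
  then have "\<not> V \<subseteq> ?S" using lt card_mono[of ?S V] finF insert by (auto simp: finite_PiE)
  then obtain v where v: "v \<in> V" "v \<notin> ?S" by auto
  have vR: "v \<in> carrier R" using v V by auto
  have nspan: "v \<noteq> (\<Oplus>i\<in>J. x i \<otimes> b i)" if x: "x \<in> J \<rightarrow> F" for x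
  proof
    assume v': "v = (\<Oplus>i\<in>J. x i \<otimes> b i)"
    have "(\<Oplus>i\<in>J. x i \<otimes> b i) = (\<Oplus>i\<in>J. restrict x J i \<otimes> b i)"
      by (rule finsum_cong') (use x bR FR in \<open>auto simp: Pi_iff subset_iff\<close>)
    moreover have "restrict x J \<in> J \<rightarrow>\<^sub>E F" using x by auto
    ultimately show False using v v' by blast
  qed
  have "indep_over R F (insert j J) (b(j := v))"
    unfolding indep_over_def
  proof (intro ballI impI)
    fix x i assume x: "x \<in> insert j J \<rightarrow> F" and i: "i \<in> insert j J"
      and s: "(\<Oplus>i\<in>insert j J. x i \<otimes> (b(j := v)) i) = \<zero>"
    have xR: "x \<in> J \<rightarrow> carrier R" "x j \<in> carrier R" using x FR by auto
    have "(\<Oplus>i\<in>insert j J. x i \<otimes> (b(j := v)) i) = x j \<otimes> v \<oplus> (\<Oplus>i\<in>J. x i \<otimes> (b(j := v)) i)"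
      using insert xR vR bR by (subst finsum_insert) (auto simp: Pi_iff)
    also have "(\<Oplus>i\<in>J. x i \<otimes> (b(j := v)) i) = (\<Oplus>i\<in>J. x i \<otimes> b i)"
      by (rule finsum_cong') (use insert xR vR bR in \<open>auto simp: Pi_iff\<close>)
    finally have s': "x j \<otimes> v \<oplus> (\<Oplus>i\<in>J. x i \<otimes> b i) = \<zero>" using s by simp
    have SR: "(\<Oplus>i\<in>J. x i \<otimes> b i) \<in> carrier R" using xR bR by (auto intro!: finsum_closed)
    \<comment> \<open>A nonzero coefficient could be inverted within \<open>F\<close>, which would
      put \<open>v\<close> into the span of the earlier vectors; \<open>c\<close> is minus that
      inverse.\<close>
    have "x j = \<zero>"
    proof (rule ccontr)
      assume nz: "x j \<noteq> \<zero>"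
      have inv: "inv (x j) \<in> F" "x j \<otimes> inv (x j) = \<one>"
        using subfield_m_inv[OF F, of "x j"] x nz by auto
      define c where "c = \<ominus> (inv (x j))"
      have c: "c \<in> F" unfolding c_def using inv subringE(5)[OF subfieldE(1)[OF F]] by auto
      have cR: "c \<in> carrier R" and iR: "inv (x j) \<in> carrier R" using c inv FR by auto
      have "x j \<otimes> v = \<ominus> (\<Oplus>i\<in>J. x i \<otimes> b i)"
        using s' SR vR xR by (metis minus_equality m_closed)
      then have "inv (x j) \<otimes> (x j \<otimes> v) = c \<otimes> (\<Oplus>i\<in>J. x i \<otimes> b i)"
        unfolding c_def using iR SR by (simp add: l_minus r_minus)
      moreover have "inv (x j) \<otimes> (x j \<otimes> v) = v"
        using inv iR xR vR by (metis l_one m_assoc m_comm)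
      ultimately have "v = c \<otimes> (\<Oplus>i\<in>J. x i \<otimes> b i)" by simp
      also have "\<dots> = (\<Oplus>i\<in>J. c \<otimes> (x i \<otimes> b i))"
        using insert xR bR cR by (intro finsum_rdistr) auto
      also have "\<dots> = (\<Oplus>i\<in>J. (c \<otimes> x i) \<otimes> b i)"
        by (rule finsum_cong') (use xR bR cR in \<open>auto simp: m_assoc Pi_iff\<close>)
      finally have "v = (\<Oplus>i\<in>J. (c \<otimes> x i) \<otimes> b i)" .
      moreover have "(\<lambda>i. c \<otimes> x i) \<in> J \<rightarrow> F"
        using x c subringE(6)[OF subfieldE(1)[OF F]] by auto
      ultimately show False using nspan by blast
    qed
    moreover have "(\<Oplus>i\<in>J. x i \<otimes> b i) = \<zero>" using s' calculation vR SR by simp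
    then have "\<forall>i\<in>J. x i = \<zero>" using b(2) x unfolding indep_over_def by auto
    ultimately show "x i = \<zero>" using i by auto
  qed
  moreover have "b(j := v) \<in> insert j J \<rightarrow> V" using b v by auto
  ultimately show ?case by blast
qed

section \<open>Colouring matrices by the syndrome of a Gabidulin code\<close>

lemma (in abelian_group) minus_eqI:
  assumes "x = y \<oplus> z" "y \<in> carrier G" "z \<in> carrier G"
  shows "x \<ominus> z = y"
  using assms by (simp add: a_minus_def a_assoc r_neg)

lemma (in abelian_group) finsum_minus:
  assumes "f \<in> A \<rightarrow> carrier G" "g \<in> A \<rightarrow> carrier G"
  shows "(\<Oplus>i\<in>A. f i \<ominus> g i) = (\<Oplus>i\<in>A. f i) \<ominus> (\<Oplus>i\<in>A. g i)"
proof -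
  have "(\<Oplus>i\<in>A. f i \<ominus> g i) \<oplus> (\<Oplus>i\<in>A. g i) = (\<Oplus>i\<in>A. f i \<ominus> g i \<oplus> g i)"
    using assms by (intro finsum_addf[symmetric]) (auto simp: Pi_iff)
  also have "\<dots> = (\<Oplus>i\<in>A. f i)"
    using assms by (intro finsum_cong') (auto simp: Pi_iff a_minus_def a_assoc l_neg)
  finally have "(\<Oplus>i\<in>A. f i) \<ominus> (\<Oplus>i\<in>A. g i) = (\<Oplus>i\<in>A. f i \<ominus> g i)"
    by (intro minus_eqI[OF sym]) (use assms in \<open>auto intro!: finsum_closed simp: Pi_iff\<close>)
  then show ?thesis ..
qed

lemma (in field) field_hom_zeroD:
  assumes "field S" and h: "h \<in> ring_hom R S" and x: "x \<in> carrier R" "h x = \<zero>\<^bsub>S\<^esub>"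
  shows "x = \<zero>"
proof (rule ccontr)
  assume "x \<noteq> \<zero>"
  then have xU: "x \<in> Units R" using x field_Units by auto
  interpret S: field S by fact
  interpret ring_hom_ring R S h by (rule ring_hom_ringI2[OF ring_axioms S.ring_axioms h])
  have "h (x \<otimes> inv x) = \<one>\<^bsub>S\<^esub>" by (simp only: Units_r_inv[OF xU] hom_one)
  moreover have "h (x \<otimes> inv x) = \<zero>\<^bsub>S\<^esub>" using x xU by (subst hom_mult) auto
  ultimately show False by simp
qed

lemma (in field) fixed_subfield:
  assumes "\<phi> \<in> ring_hom R R"
  shows "subfield {x \<in> carrier R. \<phi> x = x} R"
proof -
  interpret ring_hom_ring R R \<phi> by (rule ring_hom_ringI2[OF ring_axioms ring_axioms assms])
  have "subring {x \<in> carrier R. \<phi> x = x} R" by (rule subringI) auto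
  moreover have "inv x \<in> {x \<in> carrier R. \<phi> x = x}" if x: "x \<in> {x \<in> carrier R. \<phi> x = x} - {\<zero>}" for x
  proof -
    have xU: "x \<in> Units R" using x field_Units by auto
    have "\<phi> (inv x) \<otimes> x = \<one>"
      using x xU hom_mult[of "inv x" x] by simp
    then have "inv x = \<phi> (inv x)" using x xU by (intro comm_inv_char) (auto simp: m_comm)
    from this[symmetric]
    show ?thesis using xU by auto
  qed
  ultimately show ?thesis by (rule subfieldI')
qed

text \<open>
  Induction on the rank: scaled so that one \<open>\<beta> s\<close> is \<open>1\<close>, the vector \<open>a i = (\<Sum>s. c i s * \<beta> s)\<close> has the
  property that \<open>a - \<phi> a\<close> is of smaller rank and satisfies the equations for \<open>\<phi> \<circ> h\<close> with one fewer
  value of \<open>j\<close>. Hence \<open>a\<close> is fixed by \<open>\<phi>\<close>, and the equation for \<open>j = 0\<close> forces \<open>a = 0\<close>.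
\<close>

lemma (in field) low_rank_syndrome:
  assumes \<phi>: "\<phi> \<in> ring_hom R R" and I: "finite I" and "finite S"
    and c: "\<And>i s. i \<in> I \<Longrightarrow> s \<in> S \<Longrightarrow> c i s \<in> {x \<in> carrier R. \<phi> x = x}"
    and "\<beta> \<in> S \<rightarrow> carrier R" and "h \<in> I \<rightarrow> carrier R"
    and "indep_over R {x \<in> carrier R. \<phi> x = x} I h"
    and "\<And>j. j < card S \<Longrightarrow> (\<Oplus>i\<in>I. (\<Oplus>s\<in>S. c i s \<otimes> \<beta> s) \<otimes> (\<phi> ^^ j) (h i)) = \<zero>"
  shows "\<forall>i\<in>I. (\<Oplus>s\<in>S. c i s \<otimes> \<beta> s) = \<zero>"
  using assms(3-)
proof (induction "card S" arbitrary: S \<beta> h)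
  case 0
  then show ?case by simp
next
  case (Suc d)
  note S = \<open>finite S\<close> and c = Suc.prems(2) and \<beta> = Suc.prems(3) and h = Suc.prems(4)
    and indep = Suc.prems(5) and eq = Suc.prems(6)
  interpret \<phi>: ring_hom_cring R R \<phi>
    by (rule ring_hom_cringI[OF is_cring is_cring \<phi>])
  have pow: "(\<phi> ^^ j) x \<in> carrier R" if "x \<in> carrier R" for j x
    using that by (induction j) auto
  have hR: "h i \<in> carrier R" if "i \<in> I" for i using that h by auto
  have \<beta>R: "\<beta> s \<in> carrier R" if "s \<in> S" for s using that \<beta> by auto
  have cR: "c i s \<in> carrier R" "\<phi> (c i s) = c i s" if "i \<in> I" "s \<in> S" for i s using that c by auto
  show ?case
  proof (cases "\<forall>s\<in>S. \<beta> s = \<zero>")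
    case True
    then show ?thesis using cR by (auto intro!: add.finprod_one_eqI)
  next
    case False
    then obtain s0 where s0: "s0 \<in> S" "\<beta> s0 \<noteq> \<zero>" by auto
    define \<mu> where "\<mu> = inv (\<beta> s0)"
    have \<mu>: "\<mu> \<in> carrier R" "\<mu> \<otimes> \<beta> s0 = \<one>"
      using s0 \<beta>R field_Units by (auto simp: \<mu>_def)
    have \<mu>0: "\<mu> \<noteq> \<zero>" using \<mu> \<beta>R[OF s0(1)] by auto
    define a where "a i = \<mu> \<otimes> (\<Oplus>s\<in>S. c i s \<otimes> \<beta> s)" for i
    define \<gamma> where "\<gamma> s = \<mu> \<otimes> \<beta> s \<ominus> \<phi> (\<mu> \<otimes> \<beta> s)" for s
    have sumR: "(\<Oplus>s\<in>S. c i s \<otimes> \<beta> s) \<in> carrier R" if "i \<in> I" for i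
      using that cR \<beta>R by (auto intro!: finsum_closed)
    have aR: "a i \<in> carrier R" if "i \<in> I" for i using that sumR \<mu> by (simp add: a_def)
    have \<gamma>R: "\<gamma> s \<in> carrier R" if "s \<in> S" for s using that \<beta>R \<mu> by (simp add: \<gamma>_def)
    \<comment> \<open>The scaling serves this: \<open>1 - \<phi> 1 = 0\<close> removes the index
      \<open>s0\<close>, while the coefficients \<open>c i s\<close> stay the same because
      \<open>\<phi>\<close> fixes them.\<close>
    have \<gamma>0: "\<gamma> s0 = \<zero>" unfolding \<gamma>_def \<mu>(2) \<phi>.hom_one by (simp add: a_minus_def r_neg)
    have a_alt: "a i = (\<Oplus>s\<in>S. c i s \<otimes> (\<mu> \<otimes> \<beta> s))" if "i \<in> I" for i
      unfolding a_def using that S \<mu> cR \<beta>R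
      by (subst finsum_rdistr) (auto intro!: finsum_cong' simp: m_lcomm)
    have \<phi>a: "\<phi> (a i) = (\<Oplus>s\<in>S. c i s \<otimes> \<phi> (\<mu> \<otimes> \<beta> s))" if "i \<in> I" for i
      unfolding a_alt[OF that] using that S \<mu> cR \<beta>R
      by (subst \<phi>.hom_finsum) (auto intro!: finsum_cong' simp: Pi_iff)
    have diff: "a i \<ominus> \<phi> (a i) = (\<Oplus>s\<in>S - {s0}. c i s \<otimes> \<gamma> s)" if i: "i \<in> I" for i
    proof -
      have "(\<Oplus>s\<in>S - {s0}. c i s \<otimes> \<gamma> s) = (\<Oplus>s\<in>S. c i s \<otimes> \<gamma> s)"
        using S i cR \<gamma>R \<gamma>0 by (intro add.finprod_mono_neutral_cong_left) auto
      moreover have "a i \<ominus> \<phi> (a i) = (\<Oplus>s\<in>S. c i s \<otimes> \<gamma> s)"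
      proof (rule minus_eqI)
        show "(\<Oplus>s\<in>S. c i s \<otimes> \<gamma> s) \<in> carrier R" using i cR \<gamma>R by (auto intro!: finsum_closed)
        show "\<phi> (a i) \<in> carrier R" using aR[OF i] by simp
        have "(\<Oplus>s\<in>S. c i s \<otimes> \<gamma> s) \<oplus> \<phi> (a i) = (\<Oplus>s\<in>S. c i s \<otimes> \<gamma> s \<oplus> c i s \<otimes> \<phi> (\<mu> \<otimes> \<beta> s))"
          unfolding \<phi>a[OF i] using i cR \<gamma>R \<beta>R \<mu> by (intro finsum_addf[symmetric]) auto
        also have "\<dots> = a i"
          unfolding a_alt[OF i]
        proof (rule finsum_cong'[OF refl])
          fix s assume s: "s \<in> S"
          have "c i s \<otimes> \<gamma> s \<oplus> c i s \<otimes> \<phi> (\<mu> \<otimes> \<beta> s) = c i s \<otimes> (\<gamma> s \<oplus> \<phi> (\<mu> \<otimes> \<beta> s))"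
            using i s cR \<gamma>R \<beta>R \<mu> by (intro r_distr[symmetric]) auto
          also have "\<gamma> s \<oplus> \<phi> (\<mu> \<otimes> \<beta> s) = \<mu> \<otimes> \<beta> s"
            unfolding \<gamma>_def a_minus_def using s \<beta>R \<mu> by (subst a_assoc) (auto simp: l_neg)
          finally show "c i s \<otimes> \<gamma> s \<oplus> c i s \<otimes> \<phi> (\<mu> \<otimes> \<beta> s) = c i s \<otimes> (\<mu> \<otimes> \<beta> s)" .
        qed (use i cR \<beta>R \<mu> in auto)
        finally show "a i = (\<Oplus>s\<in>S. c i s \<otimes> \<gamma> s) \<oplus> \<phi> (a i)" ..
      qed
      ultimately show ?thesis by (simp only:)
    qed
    have eqa: "(\<Oplus>i\<in>I. a i \<otimes> (\<phi> ^^ j) (h i)) = \<zero>" if "j < card S" for j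
    proof -
      have "(\<Oplus>i\<in>I. a i \<otimes> (\<phi> ^^ j) (h i)) = \<mu> \<otimes> (\<Oplus>i\<in>I. (\<Oplus>s\<in>S. c i s \<otimes> \<beta> s) \<otimes> (\<phi> ^^ j) (h i))"
      proof -
        have "\<mu> \<otimes> (\<Oplus>i\<in>I. (\<Oplus>s\<in>S. c i s \<otimes> \<beta> s) \<otimes> (\<phi> ^^ j) (h i))
            = (\<Oplus>i\<in>I. \<mu> \<otimes> ((\<Oplus>s\<in>S. c i s \<otimes> \<beta> s) \<otimes> (\<phi> ^^ j) (h i)))"
          by (rule finsum_rdistr) (use I \<mu> sumR hR pow in auto)
        also have "\<dots> = (\<Oplus>i\<in>I. a i \<otimes> (\<phi> ^^ j) (h i))"
        proof (rule finsum_cong'[OF refl])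
          show "\<mu> \<otimes> ((\<Oplus>s\<in>S. c i s \<otimes> \<beta> s) \<otimes> (\<phi> ^^ j) (h i)) = a i \<otimes> (\<phi> ^^ j) (h i)"
            if "i \<in> I" for i
            unfolding a_def by (rule m_assoc[symmetric]) (use that \<mu> sumR hR pow in auto)
        qed (use aR hR pow in auto)
        finally show ?thesis ..
      qed
      then show ?thesis using eq[OF that] \<mu> by simp
    qed
    \<comment> \<open>A relation among the \<open>\<phi> (h i)\<close> with fixed coefficients is
      the image under the injective \<open>\<phi>\<close> of the same relation among the
      \<open>h i\<close>.\<close>
    have indep': "indep_over R {x \<in> carrier R. \<phi> x = x} I (\<lambda>i. \<phi> (h i))"
      unfolding indep_over_def
    proof (intro ballI impI)
      fix x i assume x: "x \<in> I \<rightarrow> {x \<in> carrier R. \<phi> x = x}" and i: "i \<in> I"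
        and s: "(\<Oplus>i\<in>I. x i \<otimes> \<phi> (h i)) = \<zero>"
      have xR: "x i \<in> carrier R" "\<phi> (x i) = x i" if "i \<in> I" for i using that x by auto
      have "\<phi> (\<Oplus>i\<in>I. x i \<otimes> h i) = (\<Oplus>i\<in>I. x i \<otimes> \<phi> (h i))"
        using I xR hR by (subst \<phi>.hom_finsum) (auto intro!: finsum_cong' simp: Pi_iff)
      also note s
      finally have "(\<Oplus>i\<in>I. x i \<otimes> h i) = \<zero>"
        by (rule field_hom_zeroD[OF field_axioms \<phi>, rotated])
          (use xR hR in \<open>auto intro!: finsum_closed\<close>)
      then show "x i = \<zero>" using indep x i unfolding indep_over_def by auto
    qed
    have eq': "(\<Oplus>i\<in>I. (\<Oplus>s\<in>S - {s0}. c i s \<otimes> \<gamma> s) \<otimes> (\<phi> ^^ j) (\<phi> (h i))) = \<zero>"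
      if j: "j < card (S - {s0})" for j
    proof -
      \<comment> \<open>Equation \<open>j\<close> for the differences is equation
        \<open>Suc j\<close> for \<open>a\<close> minus the \<open>\<phi>\<close>-image of equation
        \<open>j\<close>. One index is lost, just as \<open>S\<close> loses one element.\<close>
      have j': "Suc j < card S" using j S s0 by simp
      have "(\<Oplus>i\<in>I. (\<Oplus>s\<in>S - {s0}. c i s \<otimes> \<gamma> s) \<otimes> (\<phi> ^^ j) (\<phi> (h i)))
          = (\<Oplus>i\<in>I. a i \<otimes> (\<phi> ^^ Suc j) (h i) \<ominus> \<phi> (a i \<otimes> (\<phi> ^^ j) (h i)))"
      proof (rule finsum_cong'[OF refl])
        fix i assume i: "i \<in> I"
        define y where "y = (\<phi> ^^ j) (h i)"
        have y: "y \<in> carrier R" unfolding y_def using pow hR[OF i] by simp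
        have y': "(\<phi> ^^ j) (\<phi> (h i)) = \<phi> y" "(\<phi> ^^ Suc j) (h i) = \<phi> y"
          unfolding y_def by (simp_all add: funpow_swap1[of \<phi>])
        have "(a i \<ominus> \<phi> (a i)) \<otimes> \<phi> y = a i \<otimes> \<phi> y \<ominus> \<phi> (a i \<otimes> y)"
          using y aR[OF i] by (simp add: a_minus_def l_distr l_minus)
        then show "(\<Oplus>s\<in>S - {s0}. c i s \<otimes> \<gamma> s) \<otimes> (\<phi> ^^ j) (\<phi> (h i))
            = a i \<otimes> (\<phi> ^^ Suc j) (h i) \<ominus> \<phi> (a i \<otimes> (\<phi> ^^ j) (h i))"
          unfolding y' y_def[symmetric] diff[OF i] .
      qed (use aR hR pow in auto)
      also have "\<dots> = (\<Oplus>i\<in>I. a i \<otimes> (\<phi> ^^ Suc j) (h i)) \<ominus> (\<Oplus>i\<in>I. \<phi> (a i \<otimes> (\<phi> ^^ j) (h i)))"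
        using aR hR pow by (intro finsum_minus) auto
      also have "(\<Oplus>i\<in>I. \<phi> (a i \<otimes> (\<phi> ^^ j) (h i))) = \<phi> (\<Oplus>i\<in>I. a i \<otimes> (\<phi> ^^ j) (h i))"
        using I aR hR pow by (subst \<phi>.hom_finsum) (auto simp: Pi_iff comp_def)
      finally show ?thesis
        using eqa[OF j'] eqa[of j] j' by (simp add: a_minus_def)
    qed
    have rec: "\<forall>i\<in>I. (\<Oplus>s\<in>S - {s0}. c i s \<otimes> \<gamma> s) = \<zero>"
    proof (rule Suc.hyps(1)[OF _ _ _ _ _ indep' eq'])
      show "d = card (S - {s0})" using Suc.hyps(2) S s0 by simp
    qed (use S c \<gamma>R hR in auto)
    have fix_a: "\<phi> (a i) = a i" if "i \<in> I" for i
    proof -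
      have "a i \<ominus> \<phi> (a i) = \<zero>" using rec diff that by simp
      then show ?thesis using aR[OF that] by simp
    qed
    have "(\<Oplus>i\<in>I. a i \<otimes> h i) = \<zero>" using eqa[of 0] Suc.hyps(2) by simp
    moreover have "a \<in> I \<rightarrow> {x \<in> carrier R. \<phi> x = x}" using fix_a aR by blast
    ultimately have "\<forall>i\<in>I. a i = \<zero>" using indep unfolding indep_over_def by blast
    then show ?thesis using \<mu> \<mu>0 sumR by (simp add: a_def integral_iff)
  qed
qed

lemma (in abelian_monoid) finsum_mem:
  assumes "W \<subseteq> carrier G" "\<zero> \<in> W" "\<And>x y. x \<in> W \<Longrightarrow> y \<in> W \<Longrightarrow> x \<oplus> y \<in> W"
    and "\<And>i. i \<in> A \<Longrightarrow> f i \<in> W"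
  shows "(\<Oplus>i\<in>A. f i) \<in> W"
proof (cases "finite A")
  case True
  then show ?thesis using assms(4)
  proof (induction A rule: finite_induct)
    case (insert a A)
    then show ?case using assms(1,3) by (subst finsum_insert) auto
  qed (use assms in simp)
qed (use assms in simp)

text \<open>A basis \<open>b\<close> turns the rows of \<open>A\<close> into elements of the field
  with \<open>q ^ card J\<close> elements, and \<open>col A\<close> is the syndrome of these
  elements. The check matrix with entries \<open>(\<phi> ^^ j) (h i)\<close> is the Moore matrix of
  \<open>h\<close>, which defines a Gabidulin code. The factorisation through \<open>S\<close> in
  the last property expresses that \<open>A - B\<close> has rank at most \<open>d\<close>. Equal
  colours make the syndrome of \<open>A - B\<close> zero, \<open>low_rank_syndrome\<close> kills its
  rows, and independence of \<open>b\<close> kills their entries.\<close>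

lemma (in field) mrd_coloring:
  fixes I J :: "nat set" and d :: nat
  assumes q: "primepow q" "order R = q"
    and IJ: "finite I" "finite J" "J \<noteq> {}" "card I \<le> card J"
  obtains C :: "(nat \<Rightarrow> ('a list \<times> nat) multiset \<Rightarrow> 'a) set" and col
  where "finite C" "card C = q ^ (card J * d)"
    "\<And>A. (\<And>i l. i \<in> I \<Longrightarrow> l \<in> J \<Longrightarrow> A i l \<in> carrier R) \<Longrightarrow> col A \<in> C"
    "\<And>A B (S :: nat set) x y. \<lbrakk>\<And>i l. i \<in> I \<Longrightarrow> l \<in> J \<Longrightarrow> A i l \<in> carrier R;
        \<And>i l. i \<in> I \<Longrightarrow> l \<in> J \<Longrightarrow> B i l \<in> carrier R;
        finite S; card S \<le> d;
        \<And>i s. i \<in> I \<Longrightarrow> s \<in> S \<Longrightarrow> x i s \<in> carrier R; \<And>s l. s \<in> S \<Longrightarrow> l \<in> J \<Longrightarrow> y s l \<in> carrier R;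
        \<And>i l. i \<in> I \<Longrightarrow> l \<in> J \<Longrightarrow> A i l \<ominus> B i l = (\<Oplus>s\<in>S. x i s \<otimes> y s l); col A = col B\<rbrakk>
      \<Longrightarrow> \<forall>i\<in>I. \<forall>l\<in>J. A i l = B i l"
proof -
  obtain L :: "(('a list \<times> nat) multiset \<Rightarrow> 'a) ring" and \<iota>
    where L: "field L" and \<iota>: "\<iota> \<in> ring_hom R L"
      and frob: "\<And>r. (\<lambda>x. x [^]\<^bsub>L\<^esub> (q ^ r)) \<in> ring_hom L L"
      and \<iota>q: "\<And>x. x \<in> carrier R \<Longrightarrow> \<iota> x [^]\<^bsub>L\<^esub> q = \<iota> x"
      and fixf: "\<And>r. r > 0 \<Longrightarrow> finite {x \<in> carrier L. x [^]\<^bsub>L\<^esub> (q ^ r) = x}"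
      and fixc: "\<And>r. r > 0 \<Longrightarrow> card {x \<in> carrier L. x [^]\<^bsub>L\<^esub> (q ^ r) = x} = q ^ r"
    using frobenius_extension[OF q] by blast
  interpret L: field L by fact
  interpret \<iota>: ring_hom_cring R L \<iota> by (rule ring_hom_cringI[OF is_cring L.is_cring \<iota>])
  define N where "N = card J"
  \<comment> \<open>The count of the fixed points of \<open>x ^ (q ^ N)\<close> is available only
    for positive \<open>N\<close>, as every element is fixed when \<open>N = 0\<close>; this is
    where \<open>J \<noteq> {}\<close> enters.\<close>
  have N: "N > 0" using IJ by (auto simp: N_def card_gt_0_iff)
  define \<phi> where "\<phi> x = x [^]\<^bsub>L\<^esub> q" for x
  have \<phi>: "\<phi> \<in> ring_hom L L" using frob[of 1] by (simp add: \<phi>_def[abs_def])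
  define F where "F = {x \<in> carrier L. \<phi> x = x}"
  define V where "V = {x \<in> carrier L. x [^]\<^bsub>L\<^esub> (q ^ N) = x}"
  have F: "subfield F L" unfolding F_def by (rule L.fixed_subfield[OF \<phi>])
  have V: "subfield V L" unfolding V_def by (rule L.fixed_subfield[OF frob])
  have finF: "finite F" and cardF: "card F = q"
    using fixf[of 1] fixc[of 1] by (auto simp: F_def \<phi>_def)
  have finV: "finite V" and cardV: "card V = q ^ N" using fixf[OF N] fixc[OF N] by (auto simp: V_def)
  have VL: "V \<subseteq> carrier L" by (auto simp: V_def)
  note V_ring = subringE[OF subfieldE(1)[OF V]]
  have q0: "q > 0" using primepow_gt_0_nat[OF q(1)] .
  obtain b where b: "b \<in> J \<rightarrow> V" "indep_over L F J b"
    using L.exists_indep_over[OF F finF IJ(2) VL finV] cardF cardV by (auto simp: N_def)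
  \<comment> \<open>Here \<open>card I \<le> card J\<close> enters: \<open>q ^ card I\<close> must
    not exceed \<open>card V = q ^ N\<close>.\<close>
  obtain h where h: "h \<in> I \<rightarrow> V" "indep_over L F I h"
    using L.exists_indep_over[OF F finF IJ(1) VL finV] cardF cardV IJ(4) q0
    by (auto simp: N_def power_increasing)
  have bV: "b l \<in> V" "b l \<in> carrier L" if "l \<in> J" for l using that b VL by auto
  have \<phi>V: "\<phi> x \<in> V" if "x \<in> V" for x
    using that by (auto simp: V_def \<phi>_def L.nat_pow_pow mult.commute[of q])
      (metis L.nat_pow_pow mult.commute)
  have \<phi>h: "(\<phi> ^^ j) (h i) \<in> V" if "i \<in> I" for i j
    using that h \<phi>V by (induction j) auto
  have \<iota>F: "\<iota> x \<in> F" if "x \<in> carrier R" for x using that \<iota>q by (simp add: F_def \<phi>_def)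
  have FV: "x \<in> V" if "x \<in> F" for x
  proof -
    have "x [^]\<^bsub>L\<^esub> (q ^ k) = x" for k
      using that by (induction k) (auto simp: F_def \<phi>_def L.nat_pow_pow[symmetric] mult.commute[of q])
    then show ?thesis using that by (simp add: F_def V_def)
  qed
  have \<iota>V: "\<iota> x \<in> V" if "x \<in> carrier R" for x using that \<iota>F FV by blast
  define row where "row A i = (\<Oplus>\<^bsub>L\<^esub>l\<in>J. \<iota> (A i l) \<otimes>\<^bsub>L\<^esub> b l)" for A :: "nat \<Rightarrow> nat \<Rightarrow> 'a" and i
  \<comment> \<open>Restricting to \<open>{..<d}\<close> places the colour in the finite set
    \<open>{..<d} \<rightarrow>\<^sub>E V\<close>, whose size is the required power of
    \<open>q\<close>.\<close>
  define col where "col A = (\<lambda>j\<in>{..<d}. \<Oplus>\<^bsub>L\<^esub>i\<in>I. row A i \<otimes>\<^bsub>L\<^esub> (\<phi> ^^ j) (h i))" for A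
  have rowV: "row A i \<in> V" if "\<And>l. l \<in> J \<Longrightarrow> A i l \<in> carrier R" for A i
    unfolding row_def using that \<iota>V bV V_ring by (intro L.finsum_mem[OF VL]) auto
  show thesis
  proof (rule that[of "{..<d} \<rightarrow>\<^sub>E V" col])
    show "finite ({..<d} \<rightarrow>\<^sub>E V)" using finV by (simp add: finite_PiE)
    show "card ({..<d} \<rightarrow>\<^sub>E V) = q ^ (card J * d)"
      using cardV by (simp add: card_PiE N_def power_mult)
    show "col A \<in> {..<d} \<rightarrow>\<^sub>E V" if "\<And>i l. i \<in> I \<Longrightarrow> l \<in> J \<Longrightarrow> A i l \<in> carrier R" for A
      unfolding col_def using that rowV \<phi>h V_ring by (auto intro!: L.finsum_mem[OF VL])
  next
    fix A B :: "nat \<Rightarrow> nat \<Rightarrow> 'a" and S :: "nat set" and x y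
    assume A: "\<And>i l. i \<in> I \<Longrightarrow> l \<in> J \<Longrightarrow> A i l \<in> carrier R"
      and B: "\<And>i l. i \<in> I \<Longrightarrow> l \<in> J \<Longrightarrow> B i l \<in> carrier R"
      and S: "finite S" "card S \<le> d"
      and x: "\<And>i s. i \<in> I \<Longrightarrow> s \<in> S \<Longrightarrow> x i s \<in> carrier R"
      and y: "\<And>s l. s \<in> S \<Longrightarrow> l \<in> J \<Longrightarrow> y s l \<in> carrier R"
      and D: "\<And>i l. i \<in> I \<Longrightarrow> l \<in> J \<Longrightarrow> A i l \<ominus> B i l = (\<Oplus>s\<in>S. x i s \<otimes> y s l)"
      and eq: "col A = col B"
    define D where "D i l = A i l \<ominus> B i l" for i l
    have DR: "D i l \<in> carrier R" if "i \<in> I" "l \<in> J" for i l using that A B by (simp add: D_def)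
    have rowL: "row A i \<in> carrier L" "row B i \<in> carrier L" "row D i \<in> carrier L" if "i \<in> I" for i
      using rowV[of A i] rowV[of B i] rowV[of D i] A B DR that VL by auto
    have rowD: "row D i = row A i \<ominus>\<^bsub>L\<^esub> row B i" if i: "i \<in> I" for i
    proof -
      have "row D i = (\<Oplus>\<^bsub>L\<^esub>l\<in>J. \<iota> (A i l) \<otimes>\<^bsub>L\<^esub> b l \<ominus>\<^bsub>L\<^esub> \<iota> (B i l) \<otimes>\<^bsub>L\<^esub> b l)"
        unfolding row_def
        by (rule L.finsum_cong'[OF refl])
          (use i A B bV in \<open>auto simp: D_def a_minus_def L.l_distr L.l_minus\<close>)
      also have "\<dots> = row A i \<ominus>\<^bsub>L\<^esub> row B i"
        unfolding row_def by (rule L.finsum_minus) (use i A B bV in auto)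
      finally show ?thesis .
    qed
    \<comment> \<open>The field element encoded by row \<open>s\<close> of the right factor. With it
      the factorisation of \<open>A - B\<close> takes the form demanded by
      \<open>low_rank_syndrome\<close>, with coefficients \<open>\<iota> (x i s)\<close> fixed by
      \<open>\<phi>\<close>.\<close>
    define \<beta> where "\<beta> s = (\<Oplus>\<^bsub>L\<^esub>l\<in>J. \<iota> (y s l) \<otimes>\<^bsub>L\<^esub> b l)" for s
    have row_fact: "row D i = (\<Oplus>\<^bsub>L\<^esub>s\<in>S. \<iota> (x i s) \<otimes>\<^bsub>L\<^esub> \<beta> s)" if i: "i \<in> I" for i
    proof -
      have "row D i = (\<Oplus>\<^bsub>L\<^esub>l\<in>J. \<Oplus>\<^bsub>L\<^esub>s\<in>S. \<iota> (x i s) \<otimes>\<^bsub>L\<^esub> (\<iota> (y s l) \<otimes>\<^bsub>L\<^esub> b l))"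
        unfolding row_def
      proof (rule L.finsum_cong'[OF refl])
        fix l assume l: "l \<in> J"
        have "\<iota> (D i l) = (\<Oplus>\<^bsub>L\<^esub>s\<in>S. \<iota> (x i s) \<otimes>\<^bsub>L\<^esub> \<iota> (y s l))"
          unfolding D_def D[OF i l] using x y i l S
          by (subst \<iota>.hom_finsum) (auto intro!: L.finsum_cong' simp: Pi_iff)
        then have "\<iota> (D i l) \<otimes>\<^bsub>L\<^esub> b l = (\<Oplus>\<^bsub>L\<^esub>s\<in>S. \<iota> (x i s) \<otimes>\<^bsub>L\<^esub> \<iota> (y s l) \<otimes>\<^bsub>L\<^esub> b l)"
          using S x y i l bV by (simp add: L.finsum_ldistr Pi_iff)
        also have "\<dots> = (\<Oplus>\<^bsub>L\<^esub>s\<in>S. \<iota> (x i s) \<otimes>\<^bsub>L\<^esub> (\<iota> (y s l) \<otimes>\<^bsub>L\<^esub> b l))"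
          by (rule L.finsum_cong'[OF refl]) (use x y i l bV in \<open>auto simp: L.m_assoc\<close>)
        finally show "\<iota> (D i l) \<otimes>\<^bsub>L\<^esub> b l = (\<Oplus>\<^bsub>L\<^esub>s\<in>S. \<iota> (x i s) \<otimes>\<^bsub>L\<^esub> (\<iota> (y s l) \<otimes>\<^bsub>L\<^esub> b l))" .
      qed (use x y i bV in \<open>auto intro!: L.finsum_closed\<close>)
      also have "\<dots> = (\<Oplus>\<^bsub>L\<^esub>s\<in>S. \<Oplus>\<^bsub>L\<^esub>l\<in>J. \<iota> (x i s) \<otimes>\<^bsub>L\<^esub> (\<iota> (y s l) \<otimes>\<^bsub>L\<^esub> b l))"
        by (rule L.finsum_swap) (use IJ S x y i bV in auto)
      also have "\<dots> = (\<Oplus>\<^bsub>L\<^esub>s\<in>S. \<iota> (x i s) \<otimes>\<^bsub>L\<^esub> \<beta> s)"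
        unfolding \<beta>_def
        by (rule L.finsum_cong'[OF refl])
          (use IJ x y i bV in \<open>auto intro!: L.finsum_closed L.finsum_rdistr[symmetric] simp: Pi_iff\<close>)
      finally show ?thesis .
    qed
    have synd: "(\<Oplus>\<^bsub>L\<^esub>i\<in>I. row D i \<otimes>\<^bsub>L\<^esub> (\<phi> ^^ j) (h i)) = \<zero>\<^bsub>L\<^esub>" if j: "j < d" for j
    proof -
      have hL: "(\<phi> ^^ j) (h i) \<in> carrier L" if "i \<in> I" for i using \<phi>h[OF that] VL by auto
      have "(\<Oplus>\<^bsub>L\<^esub>i\<in>I. row D i \<otimes>\<^bsub>L\<^esub> (\<phi> ^^ j) (h i))
        = (\<Oplus>\<^bsub>L\<^esub>i\<in>I. row A i \<otimes>\<^bsub>L\<^esub> (\<phi> ^^ j) (h i) \<ominus>\<^bsub>L\<^esub> row B i \<otimes>\<^bsub>L\<^esub> (\<phi> ^^ j) (h i))"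
        by (rule L.finsum_cong'[OF refl])
          (use rowL hL in \<open>auto simp: rowD a_minus_def L.l_distr L.l_minus\<close>)
      also have "\<dots> = col A j \<ominus>\<^bsub>L\<^esub> col B j"
        unfolding col_def using j rowL hL by (simp add: L.finsum_minus Pi_iff)
      also have "\<dots> = \<zero>\<^bsub>L\<^esub>"
      proof -
        have "col B j \<in> carrier L"
          unfolding col_def using j rowL hL by (auto intro!: L.finsum_closed)
        then show ?thesis unfolding eq by (simp add: a_minus_def L.r_neg)
      qed
      finally show ?thesis .
    qed
    have "\<forall>i\<in>I. (\<Oplus>\<^bsub>L\<^esub>s\<in>S. \<iota> (x i s) \<otimes>\<^bsub>L\<^esub> \<beta> s) = \<zero>\<^bsub>L\<^esub>"
    proof (rule L.low_rank_syndrome[OF \<phi> IJ(1) S(1), where h = h])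
      show "\<beta> \<in> S \<rightarrow> carrier L" unfolding \<beta>_def using y bV by (auto intro!: L.finsum_closed)
      show "h \<in> I \<rightarrow> carrier L" using h VL by auto
      show "indep_over L {x \<in> carrier L. \<phi> x = x} I h" using h(2) unfolding F_def .
      show "\<iota> (x i s) \<in> {x \<in> carrier L. \<phi> x = x}" if "i \<in> I" "s \<in> S" for i s
        using \<iota>F[OF x[OF that]] unfolding F_def .
      fix j assume "j < card S"
      then have j: "j < d" using S by simp
      have "(\<Oplus>\<^bsub>L\<^esub>i\<in>I. (\<Oplus>\<^bsub>L\<^esub>s\<in>S. \<iota> (x i s) \<otimes>\<^bsub>L\<^esub> \<beta> s) \<otimes>\<^bsub>L\<^esub> (\<phi> ^^ j) (h i))
          = (\<Oplus>\<^bsub>L\<^esub>i\<in>I. row D i \<otimes>\<^bsub>L\<^esub> (\<phi> ^^ j) (h i))"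
        by (rule L.finsum_cong'[OF refl]) (use rowL subsetD[OF VL \<phi>h] in \<open>auto simp: row_fact[symmetric]\<close>)
      then show "(\<Oplus>\<^bsub>L\<^esub>i\<in>I. (\<Oplus>\<^bsub>L\<^esub>s\<in>S. \<iota> (x i s) \<otimes>\<^bsub>L\<^esub> \<beta> s) \<otimes>\<^bsub>L\<^esub> (\<phi> ^^ j) (h i)) = \<zero>\<^bsub>L\<^esub>"
        using synd[OF j] by simp
    qed
    then have row0: "row D i = \<zero>\<^bsub>L\<^esub>" if "i \<in> I" for i using that row_fact by simp
    show "\<forall>i\<in>I. \<forall>l\<in>J. A i l = B i l"
    proof (intro ballI)
      fix i l assume i: "i \<in> I" and l: "l \<in> J"
      have "(\<lambda>l. \<iota> (D i l)) \<in> J \<rightarrow> F" using DR[OF i] \<iota>F by auto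
      from bspec[OF b(2)[unfolded indep_over_def] this] row0[OF i] l
      have "\<iota> (D i l) = \<zero>\<^bsub>L\<^esub>" unfolding row_def by blast
      then have "D i l = \<zero>" using field_hom_zeroD[OF L \<iota>] DR i l by blast
      then show "A i l = B i l" using A[OF i l] B[OF i l] by (simp add: D_def)
    qed
  qed
qed

section \<open>Subspaces of the coordinate space\<close>

locale finite_field = field K for K :: "'a ring" (structure) +
  assumes finite_carrier: "finite (carrier K)"
begin

lemma order_ge_2: "order K \<ge> 2"
  using card_mono[OF finite_carrier, of "{\<zero>, \<one>}"] by (simp add: order_def)

lemma coord_space_vectorspace: "vectorspace K (coord_space K n)"
  unfolding coord_space_def using func_space_is_module field_axioms
  by (simp add: vectorspace_def)

lemma coord_space_simps:
  "carrier (coord_space K n) = {0..<n} \<rightarrow>\<^sub>E carrier K"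
  "zero (coord_space K n) = (\<lambda>i\<in>{0..<n}. \<zero>)"
  "add (coord_space K n) = (\<lambda>v w. \<lambda>i\<in>{0..<n}. v i \<oplus> w i)"
  "smult (coord_space K n) = (\<lambda>c v. \<lambda>i\<in>{0..<n}. c \<otimes> v i)"
  unfolding coord_space_def func_space_def by simp_all

lemma subspace_iff:
  "subspace K U (coord_space K n) \<longleftrightarrow>
     U \<subseteq> {0..<n} \<rightarrow>\<^sub>E carrier K \<and> (\<lambda>i\<in>{0..<n}. \<zero>) \<in> U \<and>
     (\<forall>v\<in>U. \<forall>w\<in>U. (\<lambda>i\<in>{0..<n}. v i \<oplus> w i) \<in> U) \<and>
     (\<forall>c\<in>carrier K. \<forall>v\<in>U. (\<lambda>i\<in>{0..<n}. c \<otimes> v i) \<in> U)"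
proof -
  have "module K (coord_space K n)"
    using coord_space_vectorspace by (simp add: vectorspace_def)
  then show ?thesis
    using coord_space_vectorspace
    unfolding subspace_def submodule_def by (auto simp: coord_space_simps)
qed

lemma subspaceD:
  assumes "subspace K U (coord_space K n)"
  shows "v \<in> U \<Longrightarrow> v \<in> {0..<n} \<rightarrow>\<^sub>E carrier K" "(\<lambda>i\<in>{0..<n}. \<zero>) \<in> U"
    "v \<in> U \<Longrightarrow> w \<in> U \<Longrightarrow> (\<lambda>i\<in>{0..<n}. v i \<oplus> w i) \<in> U"
    "c \<in> carrier K \<Longrightarrow> v \<in> U \<Longrightarrow> (\<lambda>i\<in>{0..<n}. c \<otimes> v i) \<in> U"
    "v \<in> U \<Longrightarrow> i < n \<Longrightarrow> v i \<in> carrier K"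
proof -
  show mem: "v \<in> {0..<n} \<rightarrow>\<^sub>E carrier K" if "v \<in> U" for v
    using assms that unfolding subspace_iff by auto
  show "v \<in> U \<Longrightarrow> i < n \<Longrightarrow> v i \<in> carrier K" using PiE_mem[OF mem, of v i] by simp
qed (use assms in \<open>auto simp: subspace_iff\<close>)

lemma subspace_minus:
  assumes U: "subspace K U (coord_space K n)" and v: "v \<in> U" and w: "w \<in> U"
  shows "(\<lambda>i\<in>{0..<n}. v i \<ominus> w i) \<in> U"
proof -
  have "(\<lambda>i\<in>{0..<n}. v i \<oplus> (\<lambda>i\<in>{0..<n}. \<ominus> \<one> \<otimes> w i) i) \<in> U"
    using U v w by (intro subspaceD(3,4)) auto
  also have "(\<lambda>i\<in>{0..<n}. v i \<oplus> (\<lambda>i\<in>{0..<n}. \<ominus> \<one> \<otimes> w i) i) = (\<lambda>i\<in>{0..<n}. v i \<ominus> w i)"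
    using subspaceD(5)[OF U w] by (intro restrict_ext) (simp add: a_minus_def l_minus)
  finally show ?thesis .
qed

lemma subspace_Int:
  assumes "subspace K U (coord_space K n)" "subspace K W (coord_space K n)"
  shows "subspace K (U \<inter> W) (coord_space K n)"
  using assms unfolding subspace_iff by auto

lemma finite_subspace: "subspace K U (coord_space K n) \<Longrightarrow> finite U"
  unfolding subspace_iff
  by (rule finite_subset[of U "{0..<n} \<rightarrow>\<^sub>E carrier K"]) (auto simp: finite_PiE finite_carrier)

text \<open>Coordinates with respect to a basis identify \<open>U\<close> with the functions from
  the basis to \<open>K\<close>. Later dimensions are obtained by counting, which avoids handling
  bases of intersections and of explicit subspaces.\<close>

lemma card_subspace:
  assumes U: "subspace K U (coord_space K n)"
  shows "card U = order K ^ subspace_dim K n U"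
proof -
  let ?V = "(coord_space K n)\<lparr>carrier := U\<rparr>"
  interpret V: vectorspace K ?V
    by (rule vectorspace.subspace_is_vs[OF coord_space_vectorspace U])
  have cV: "carrier ?V = U" by simp
  have "V.gen_set U"
    using V.in_own_span[of U] V.span_is_subset2[of U] by auto
  then have "V.fin_dim" unfolding V.fin_dim_def using finite_subspace[OF U] by auto
  then obtain \<B> where \<B>: "finite \<B>" "V.basis \<B>" using V.finite_basis_exists by blast
  have sub: "\<B> \<subseteq> carrier ?V" using \<B>(2) unfolding V.basis_def by simp
  have ex1: "\<exists>!a. a \<in> \<B> \<rightarrow>\<^sub>E carrier K \<and> V.lincomb a \<B> = v" if "v \<in> U" for v
    using V.basis_criterion[OF \<B>(1) sub] \<B>(2) that by simp
  have "bij_betw (\<lambda>a. V.lincomb a \<B>) (\<B> \<rightarrow>\<^sub>E carrier K) U"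
    unfolding bij_betw_def
  proof
    have clos: "V.lincomb a \<B> \<in> U" if "a \<in> \<B> \<rightarrow>\<^sub>E carrier K" for a
      using V.lincomb_closed[OF sub, of a] that by auto
    show "inj_on (\<lambda>a. V.lincomb a \<B>) (\<B> \<rightarrow>\<^sub>E carrier K)"
    proof (rule inj_onI)
      fix a a' assume a: "a \<in> \<B> \<rightarrow>\<^sub>E carrier K" "a' \<in> \<B> \<rightarrow>\<^sub>E carrier K"
        "V.lincomb a \<B> = V.lincomb a' \<B>"
      then show "a = a'" using ex1[OF clos[OF a(1)]] by auto
    qed
    show "(\<lambda>a. V.lincomb a \<B>) ` (\<B> \<rightarrow>\<^sub>E carrier K) = U"
    proof (intro equalityI subsetI)
      fix v assume "v \<in> U"
      from ex1_implies_ex[OF ex1[OF this]] show "v \<in> (\<lambda>a. V.lincomb a \<B>) ` (\<B> \<rightarrow>\<^sub>E carrier K)"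
        by auto
    qed (use clos in auto)
  qed
  then have "card U = card (\<B> \<rightarrow>\<^sub>E carrier K)" by (simp add: bij_betw_same_card)
  then show ?thesis
    unfolding subspace_dim_def V.dim_basis[OF \<B>] using \<B>(1) by (simp add: card_PiE order_def)
qed

lemma subspace_dim_eqI:
  assumes "subspace K U (coord_space K n)" "card U = order K ^ d"
  shows "subspace_dim K n U = d"
  using card_subspace[OF assms(1)] assms(2) order_ge_2 by simp

lemma subspace_dim_geI:
  assumes "subspace K U (coord_space K n)" "order K ^ d \<le> card U"
  shows "d \<le> subspace_dim K n U"
  using card_subspace[OF assms(1)] assms(2) order_ge_2 by simp

lemma subspace_comb:
  assumes U: "subspace K U (coord_space K n)" and "finite A"
    and "\<And>i. i \<in> A \<Longrightarrow> c i \<in> carrier K" "\<And>i. i \<in> A \<Longrightarrow> u i \<in> U"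
  shows "(\<lambda>l\<in>{0..<n}. \<Oplus>i\<in>A. c i \<otimes> u i l) \<in> U"
  using assms(2-)
proof (induction A rule: finite_induct)
  case empty
  then show ?case using subspaceD(2)[OF U] by (simp only: finsum_empty)
next
  case (insert a A)
  have "(\<lambda>l\<in>{0..<n}. (\<lambda>l\<in>{0..<n}. c a \<otimes> u a l) l \<oplus> (\<lambda>l\<in>{0..<n}. \<Oplus>i\<in>A. c i \<otimes> u i l) l) \<in> U"
    using U insert by (intro subspaceD(3,4)) auto
  also have "(\<lambda>l\<in>{0..<n}. (\<lambda>l\<in>{0..<n}. c a \<otimes> u a l) l \<oplus> (\<lambda>l\<in>{0..<n}. \<Oplus>i\<in>A. c i \<otimes> u i l) l)
      = (\<lambda>l\<in>{0..<n}. \<Oplus>i\<in>insert a A. c i \<otimes> u i l)"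
    using insert subspaceD(5)[OF U] by (intro restrict_ext) auto
  finally show ?case .
qed

text \<open>On the coordinates \<open>Z\<close> the vectors \<open>u z\<close> form the identity
  matrix, like the rows of a generator matrix in systematic form. If moreover only the zero vector
  of \<open>U\<close> vanishes on \<open>Z\<close>, they are a basis, and their other coordinates
  are the matrix that presents \<open>U\<close> as a graph over \<open>Z\<close>.\<close>

definition unit_system :: "(nat \<Rightarrow> 'a) set \<Rightarrow> nat set \<Rightarrow> (nat \<Rightarrow> nat \<Rightarrow> 'a) \<Rightarrow> bool" where
  "unit_system U Z u \<longleftrightarrow> (\<forall>z\<in>Z. u z \<in> U \<and> (\<forall>z'\<in>Z. u z z' = (if z' = z then \<one> else \<zero>)))"

lemma subspace_determined:
  assumes U: "subspace K U (coord_space K n)"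
    and P: "\<And>v. v \<in> U \<Longrightarrow> \<forall>i\<in>P. v i = \<zero> \<Longrightarrow> v = (\<lambda>i\<in>{0..<n}. \<zero>)" "P \<subseteq> {0..<n}"
    and v: "v \<in> U" and w: "w \<in> U" and eq: "\<forall>i\<in>P. v i = w i"
  shows "v = w"
proof -
  have "(\<lambda>i\<in>{0..<n}. v i \<ominus> w i) = (\<lambda>i\<in>{0..<n}. \<zero>)"
  proof (rule P(1)[OF subspace_minus[OF U v w]], intro ballI)
    fix i assume i: "i \<in> P"
    then have "i < n" using P(2) by auto
    then show "(\<lambda>i\<in>{0..<n}. v i \<ominus> w i) i = \<zero>"
      using i eq subspaceD(5)[OF U w] by (simp add: a_minus_def r_neg)
  qed
  then have eq0: "(\<lambda>i\<in>{0..<n}. v i \<ominus> w i) i = (\<lambda>i\<in>{0..<n}. \<zero>) i" for i by (rule fun_cong)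
  have "v i \<ominus> w i = \<zero>" if "i < n" for i
    using that eq0[of i] by simp
  then have "v i = w i" if "i < n" for i
    using that subspaceD(5)[OF U v] subspaceD(5)[OF U w] by simp
  then show ?thesis using subspaceD(1)[OF U v] subspaceD(1)[OF U w] by (intro PiE_ext) auto
qed

text \<open>A unit system on a coordinate set \<open>Z\<close> of maximal size is a basis of the subspace: a nonzero
  vector vanishing on \<open>Z\<close> could be used to enlarge \<open>Z\<close>.\<close>

lemma exists_information_set:
  assumes U: "subspace K U (coord_space K n)"
    and P: "\<And>v. v \<in> U \<Longrightarrow> \<forall>i\<in>P. v i = \<zero> \<Longrightarrow> v = (\<lambda>i\<in>{0..<n}. \<zero>)" "P \<subseteq> {0..<n}"
  obtains Z u where "Z \<subseteq> P" "card Z = subspace_dim K n U" "unit_system U Z u"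
    "\<And>v. v \<in> U \<Longrightarrow> \<forall>i\<in>Z. v i = \<zero> \<Longrightarrow> v = (\<lambda>i\<in>{0..<n}. \<zero>)"
proof -
  have finP: "finite P" using P(2) finite_subset by blast
  let ?ok = "\<lambda>Z. Z \<subseteq> P \<and> (\<exists>u. unit_system U Z u)"
  have ok0: "?ok {}" by (simp add: unit_system_def)
  have "card Z \<le> card P" if "?ok Z" for Z using that finP card_mono by blast
  then have "\<exists>Z. ?ok Z \<and> (\<forall>Z'. ?ok Z' \<longrightarrow> card Z' \<le> card Z)"
    by (intro ex_has_greatest_nat[of ?ok "{}" card "Suc (card P)"] ok0) (auto simp: less_Suc_eq_le)
  then obtain Z where Z: "?ok Z" and mx: "\<And>Z'. ?ok Z' \<Longrightarrow> card Z' \<le> card Z" by metis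
  from Z obtain u where ZP: "Z \<subseteq> P" and u: "unit_system U Z u" by blast
  have finZ: "finite Z" using ZP finP finite_subset by blast
  have uU: "u z \<in> U" if "z \<in> Z" for z using that u by (simp add: unit_system_def)
  have uK: "u z i \<in> carrier K" if "z \<in> Z" "i < n" for z i using that uU subspaceD(5)[OF U] by blast
  have uz: "u z z' = (if z' = z then \<one> else \<zero>)" if "z \<in> Z" "z' \<in> Z" for z z'
    using that u by (simp add: unit_system_def)
  have Zn: "z < n" if "z \<in> Z" for z using that ZP P(2) by auto
  have det: "v = (\<lambda>i\<in>{0..<n}. \<zero>)" if v: "v \<in> U" and v0: "\<forall>i\<in>Z. v i = \<zero>" for v
  proof (rule ccontr)
    assume "v \<noteq> (\<lambda>i\<in>{0..<n}. \<zero>)"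
    then obtain p where p: "p \<in> P" "v p \<noteq> \<zero>" using P(1)[OF v] by auto
    have pn: "p < n" and pZ: "p \<notin> Z" using p P(2) v0 by auto
    have vp: "v p \<in> carrier K" "v p \<in> Units K" using subspaceD(5)[OF U v pn] p(2) field_Units by auto
    define w where "w = (\<lambda>i\<in>{0..<n}. inv (v p) \<otimes> v i)"
    have w: "w \<in> U" unfolding w_def using vp v U by (intro subspaceD(4)) auto
    have w1: "w p = \<one>" "\<And>z. z \<in> Z \<Longrightarrow> w z = \<zero>" using pn vp v0 Zn by (auto simp: w_def)
    have wK: "w i \<in> carrier K" if "i < n" for i using subspaceD(5)[OF U w that] .
    \<comment> \<open>The vector \<open>w\<close> is \<open>1\<close> at \<open>p\<close> and
      vanishes on \<open>Z\<close>, so subtracting a multiple of it clears coordinate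
      \<open>p\<close> of the old vectors without disturbing their unit pattern.\<close>
    define u' where "u' z = (if z = p then w else (\<lambda>i\<in>{0..<n}. u z i \<ominus> (\<lambda>i\<in>{0..<n}. u z p \<otimes> w i) i))" for z
    have "unit_system U (insert p Z) u'"
      unfolding unit_system_def
    proof (intro ballI conjI)
      fix z assume z: "z \<in> insert p Z"
      show "u' z \<in> U"
      proof (cases "z = p")
        case False
        then have "z \<in> Z" using z by simp
        then have "(\<lambda>i\<in>{0..<n}. u z i \<ominus> (\<lambda>i\<in>{0..<n}. u z p \<otimes> w i) i) \<in> U"
          using uU uK[OF _ pn] w by (intro subspace_minus[OF U] subspaceD(4)[OF U])
        then show ?thesis using False by (simp only: u'_def if_False)
      qed (simp add: u'_def w)
      fix z' assume z': "z' \<in> insert p Z"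
      show "u' z z' = (if z' = z then \<one> else \<zero>)"
        using z z' pn Zn w1 uz uK pZ by (auto simp: u'_def a_minus_def r_neg)
    qed
    then have "card (insert p Z) \<le> card Z" using ZP p by (intro mx) blast
    then show False using pZ finZ by simp
  qed
  \<comment> \<open>Restriction to \<open>Z\<close> is a bijection from \<open>U\<close> to
    \<open>K^Z\<close>: injective since \<open>Z\<close> determines the vectors, onto by combining
    the unit system. Counting both sides yields the dimension.\<close>
  have inj: "inj_on (\<lambda>v. restrict v Z) U"
  proof (rule inj_onI)
    fix v w assume vw: "v \<in> U" "w \<in> U" and eq: "restrict v Z = restrict w Z"
    have "\<forall>i\<in>Z. v i = w i"
    proof
      fix i assume "i \<in> Z"
      then show "v i = w i" using fun_cong[OF eq, of i] by simp
    qed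
    then show "v = w" using subspace_determined[OF U det _ vw] ZP P(2) by blast
  qed
  have "(\<lambda>v. restrict v Z) ` U = Z \<rightarrow>\<^sub>E carrier K"
  proof
    show "(\<lambda>v. restrict v Z) ` U \<subseteq> Z \<rightarrow>\<^sub>E carrier K" using subspaceD(5)[OF U] Zn by auto
    show "Z \<rightarrow>\<^sub>E carrier K \<subseteq> (\<lambda>v. restrict v Z) ` U"
    proof
      fix a assume a: "a \<in> Z \<rightarrow>\<^sub>E carrier K"
      have aK: "a z \<in> carrier K" if "z \<in> Z" for z using PiE_mem[OF a that] .
      let ?v = "\<lambda>l\<in>{0..<n}. \<Oplus>i\<in>Z. a i \<otimes> u i l"
      have v: "?v \<in> U" using aK uU by (intro subspace_comb[OF U finZ]) auto
      have r: "restrict ?v Z = a"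
      proof (rule PiE_ext)
        show "restrict ?v Z \<in> Z \<rightarrow>\<^sub>E carrier K"
          using aK uK Zn by (auto intro!: finsum_closed)
        fix z assume z: "z \<in> Z"
        have "(\<Oplus>i\<in>Z. a i \<otimes> u i z) = (\<Oplus>i\<in>Z. if z = i then a i else \<zero>)"
          using aK uz z by (intro finsum_cong') auto
        also have "\<dots> = a z" using z finZ aK by (intro finsum_singleton) auto
        finally show "restrict ?v Z z = a z" using z Zn by simp
      qed (use a in auto)
      show "a \<in> (\<lambda>v. restrict v Z) ` U" using imageI[OF v, of "\<lambda>v. restrict v Z"] unfolding r .
    qed
  qed
  then have "card U = card (Z \<rightarrow>\<^sub>E carrier K)" using card_image[OF inj] by simp
  then have "subspace_dim K n U = card Z"
    using finZ by (intro subspace_dim_eqI[OF U]) (simp add: card_PiE order_def)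
  from that[OF ZP this[symmetric] u det] show thesis .
qed

end

section \<open>Adjacent vertices and low-rank differences\<close>

context finite_field
begin

lemma unit_system_expansion:
  assumes U: "subspace K U (coord_space K n)"
    and P: "\<And>v. v \<in> U \<Longrightarrow> \<forall>i\<in>P. v i = \<zero> \<Longrightarrow> v = (\<lambda>i\<in>{0..<n}. \<zero>)" "P \<subseteq> {0..<n}"
    and u: "unit_system U P u" and v: "v \<in> U"
  shows "v = (\<lambda>l\<in>{0..<n}. \<Oplus>i\<in>P. v i \<otimes> u i l)"
proof (rule subspace_determined[OF U P v])
  have fin: "finite P" using P(2) finite_subset by blast
  have vK: "v i \<in> carrier K" if "i \<in> P" for i using that P(2) subspaceD(5)[OF U v] by auto
  have uz: "u z z' = (if z' = z then \<one> else \<zero>)" if "z \<in> P" "z' \<in> P" for z z'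
    using that u by (simp add: unit_system_def)
  show "(\<lambda>l\<in>{0..<n}. \<Oplus>i\<in>P. v i \<otimes> u i l) \<in> U"
    using vK u by (intro subspace_comb[OF U fin]) (auto simp: unit_system_def)
  show "\<forall>l\<in>P. v l = (\<lambda>l\<in>{0..<n}. \<Oplus>i\<in>P. v i \<otimes> u i l) l"
  proof
    fix l assume l: "l \<in> P"
    have "(\<Oplus>i\<in>P. v i \<otimes> u i l) = (\<Oplus>i\<in>P. if l = i then v i else \<zero>)"
      using vK uz l by (intro finsum_cong') auto
    also have "\<dots> = v l" using l fin vK by (intro finsum_singleton) auto
    finally show "v l = (\<lambda>l\<in>{0..<n}. \<Oplus>i\<in>P. v i \<otimes> u i l) l" using l P(2) by auto
  qed
qed

text \<open>A vector \<open>v\<close> of the intersection has the same coordinates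
  \<open>v j\<close>, \<open>j \<in> P\<close>, with respect to both systems, so
  \<open>\<Sum>j. v j * (u j - w j) = 0\<close>. An intersection of dimension at least
  \<open>t\<close> thus yields \<open>t\<close> independent relations among the rows of the
  difference, and these are solved for \<open>t\<close> of the rows.\<close>

lemma low_rank_difference:
  assumes U: "subspace K U (coord_space K n)" and W: "subspace K W (coord_space K n)"
    and P: "P \<subseteq> {0..<n}"
    and detU: "\<And>v. v \<in> U \<Longrightarrow> \<forall>i\<in>P. v i = \<zero> \<Longrightarrow> v = (\<lambda>i\<in>{0..<n}. \<zero>)"
    and detW: "\<And>v. v \<in> W \<Longrightarrow> \<forall>i\<in>P. v i = \<zero> \<Longrightarrow> v = (\<lambda>i\<in>{0..<n}. \<zero>)"
    and u: "unit_system U P u" and w: "unit_system W P w"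
    and t: "t \<le> subspace_dim K n (U \<inter> W)"
  obtains S x where "S \<subseteq> P" "card S = card P - t"
    "\<And>i s. i \<in> P \<Longrightarrow> s \<in> S \<Longrightarrow> x i s \<in> carrier K"
    "\<And>i l. i \<in> P \<Longrightarrow> l < n \<Longrightarrow> u i l \<ominus> w i l = (\<Oplus>s\<in>S. x i s \<otimes> (u s l \<ominus> w s l))"
proof -
  have fin: "finite P" using P finite_subset by blast
  have UW: "subspace K (U \<inter> W) (coord_space K n)" by (rule subspace_Int[OF U W])
  have detUW: "v = (\<lambda>i\<in>{0..<n}. \<zero>)" if "v \<in> U \<inter> W" "\<forall>i\<in>P. v i = \<zero>" for v
    using detU that by blast
  \<comment> \<open>Since \<open>P\<close> determines the vectors of \<open>U\<close>, it determines
    those of \<open>U \<inter> W\<close>; an information set of the intersection can therefore be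
    found inside \<open>P\<close>, where it indexes rows of the difference.\<close>
  obtain Z0 y where Z0: "Z0 \<subseteq> P" "card Z0 = subspace_dim K n (U \<inter> W)" and y0: "unit_system (U \<inter> W) Z0 y"
    by (rule exists_information_set[OF UW detUW P])
  obtain Z where Z: "Z \<subseteq> Z0" "card Z = t"
    using obtain_subset_with_card_n[of t Z0] t Z0(2) by metis
  have ZP: "Z \<subseteq> P" using Z Z0 by auto
  have finZ: "finite Z" using ZP fin finite_subset by blast
  have y: "y z \<in> U" "y z \<in> W" if "z \<in> Z" for z
    using that Z(1) y0 by (auto simp: unit_system_def)
  have yz: "y z z' = (if z' = z then \<one> else \<zero>)" if "z \<in> Z" "z' \<in> Z" for z z'
    using subsetD[OF Z(1) that(1)] subsetD[OF Z(1) that(2)] y0 by (simp add: unit_system_def)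
  have yK: "y z i \<in> carrier K" if "z \<in> Z" "i \<in> P" for z i
    using that y P subspaceD(5)[OF U] by auto
  define D where "D i l = u i l \<ominus> w i l" for i l
  have uK: "u i l \<in> carrier K" and wK: "w i l \<in> carrier K" if "i \<in> P" "l < n" for i l
    using that u w subspaceD(5)[OF U] subspaceD(5)[OF W] by (auto simp: unit_system_def)
  have DK: "D i l \<in> carrier K" if "i \<in> P" "l < n" for i l using that uK wK by (simp add: D_def)
  let ?S = "P - Z"
  \<comment> \<open>For \<open>i \<in> Z\<close> the vector \<open>y i\<close> is \<open>1\<close>
    at \<open>i\<close> and \<open>0\<close> on the rest of \<open>Z\<close>, so its relation
    expresses row \<open>i\<close> of \<open>D\<close> by the rows outside \<open>Z\<close>, with
    coefficients \<open>\<ominus> y i s\<close>.\<close>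
  define x where "x i s = (if i \<in> Z then \<ominus> y i s else if i = s then \<one> else \<zero>)" for i s
  show thesis
  proof (rule that[of ?S x])
    show "card ?S = card P - t" using Z(2) ZP finZ by (simp add: card_Diff_subset)
    show "x i s \<in> carrier K" if "i \<in> P" "s \<in> ?S" for i s using that yK by (simp add: x_def)
    fix i l assume i: "i \<in> P" and l: "l < n"
    show "u i l \<ominus> w i l = (\<Oplus>s\<in>?S. x i s \<otimes> (u s l \<ominus> w s l))"
      unfolding D_def[symmetric]
    proof (cases "i \<in> Z")
      case False
      have "(\<Oplus>s\<in>?S. x i s \<otimes> D s l) = (\<Oplus>s\<in>?S. if i = s then D s l else \<zero>)"
        using False DK l by (intro finsum_cong') (auto simp: x_def)
      also have "\<dots> = D i l" using False i l fin DK by (intro finsum_singleton) auto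
      finally show "D i l = (\<Oplus>s\<in>?S. x i s \<otimes> D s l)" ..
    next
      case True
      have yi: "y i j \<in> carrier K" if "j \<in> P" for j using yK True that by blast
      have "(\<Oplus>j\<in>P. y i j \<otimes> u j l) = y i l"
        using fun_cong[OF unit_system_expansion[OF U detU P u y(1)[OF True]], of l] l by simp
      moreover have "(\<Oplus>j\<in>P. y i j \<otimes> w j l) = y i l"
        using fun_cong[OF unit_system_expansion[OF W detW P w y(2)[OF True]], of l] l by simp
      moreover have "(\<Oplus>j\<in>P. y i j \<otimes> D j l) = (\<Oplus>j\<in>P. y i j \<otimes> u j l \<ominus> y i j \<otimes> w j l)"
        using yi uK wK l by (intro finsum_cong') (auto simp: D_def a_minus_def r_distr r_minus)
      moreover have "\<dots> = (\<Oplus>j\<in>P. y i j \<otimes> u j l) \<ominus> (\<Oplus>j\<in>P. y i j \<otimes> w j l)"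
        using yi uK wK l by (intro finsum_minus) auto
      moreover have "y i l \<in> carrier K" using subspaceD(5)[OF U y(1)[OF True] l] .
      ultimately have "(\<Oplus>j\<in>P. y i j \<otimes> D j l) = \<zero>" by (simp add: a_minus_def r_neg)
      moreover have "(\<Oplus>j\<in>Z \<union> ?S. y i j \<otimes> D j l) = (\<Oplus>j\<in>Z. y i j \<otimes> D j l) \<oplus> (\<Oplus>j\<in>?S. y i j \<otimes> D j l)"
        using finZ fin yi DK l ZP by (intro finsum_Un_disjoint) auto
      moreover have "Z \<union> ?S = P" using ZP by auto
      moreover have "(\<Oplus>j\<in>Z. y i j \<otimes> D j l) = D i l"
      proof -
        have "(\<Oplus>j\<in>Z. y i j \<otimes> D j l) = (\<Oplus>j\<in>Z. if i = j then D j l else \<zero>)"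
          using yz True DK l ZP by (intro finsum_cong') auto
        also have "\<dots> = D i l" using True finZ DK l ZP by (intro finsum_singleton) auto
        finally show ?thesis .
      qed
      ultimately have sum0: "D i l \<oplus> (\<Oplus>j\<in>?S. y i j \<otimes> D j l) = \<zero>" by simp
      have "(\<Oplus>j\<in>?S. \<ominus> y i j \<otimes> D j l) \<oplus> (\<Oplus>j\<in>?S. y i j \<otimes> D j l) = (\<Oplus>j\<in>?S. \<ominus> y i j \<otimes> D j l \<oplus> y i j \<otimes> D j l)"
        using yi DK l by (intro finsum_addf[symmetric]) auto
      also have "\<dots> = \<zero>"
        using yi DK l by (intro add.finprod_one_eqI) (auto simp: l_minus l_neg)
      finally have sum1: "(\<Oplus>j\<in>?S. \<ominus> y i j \<otimes> D j l) \<oplus> (\<Oplus>j\<in>?S. y i j \<otimes> D j l) = \<zero>" .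
      have "(\<Oplus>j\<in>?S. y i j \<otimes> D j l) \<in> carrier K" "(\<Oplus>j\<in>?S. \<ominus> y i j \<otimes> D j l) \<in> carrier K"
        using yi DK l by (auto intro!: finsum_closed)
      then have "D i l = (\<Oplus>j\<in>?S. \<ominus> y i j \<otimes> D j l)"
        using sum0 sum1 DK[OF i l] by (metis add.r_cancel)
      also have "\<dots> = (\<Oplus>s\<in>?S. x i s \<otimes> D s l)"
        using yi DK l True by (intro finsum_cong') (auto simp: x_def)
      finally show "D i l = (\<Oplus>s\<in>?S. x i s \<otimes> D s l)" .
    qed
  qed auto
qed

end

section \<open>Colourings, cliques and the chromatic number\<close>

lemma chromatic_number_le_card:
  assumes "finite C" "f \<in> pverts G \<rightarrow> C" "parcs G \<subseteq> pverts G \<times> pverts G"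
    and "\<And>u v. (u, v) \<in> parcs G \<Longrightarrow> f u \<noteq> f v"
  shows "\<exists>c. proper_coloring G (card C) c" "chromatic_number G \<le> card C"
proof -
  obtain g where g: "bij_betw g C {..<card C}"
    using ex_bij_betw_finite_nat[OF assms(1)] by (auto simp: atLeast0LessThan)
  have "g (f u) \<in> {..<card C}" if "u \<in> pverts G" for u
    using that g assms(2) by (auto simp: bij_betw_def)
  moreover have "g (f u) \<noteq> g (f v)" if uv: "(u, v) \<in> parcs G" for u v
  proof
    assume eq: "g (f u) = g (f v)"
    have "u \<in> pverts G" "v \<in> pverts G" using uv assms(3) by auto
    then have "f u \<in> C" "f v \<in> C" using assms(2) by auto
    then have "f u = f v" using g eq by (auto simp: bij_betw_def dest: inj_onD)
    then show False using assms(4)[OF uv] by simp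
  qed
  ultimately have "proper_coloring G (card C) (\<lambda>u. g (f u))"
    unfolding proper_coloring_def by auto
  then show "\<exists>c. proper_coloring G (card C) c" by blast
  then show "chromatic_number G \<le> card C" unfolding chromatic_number_def by (rule Least_le)
qed

text \<open>A colouring is injective on a clique. That some colouring exists has to be assumed, as
  otherwise the \<open>LEAST\<close> in \<open>chromatic_number\<close> is an unspecified value; for
  this reason the upper bounds also export a colouring.\<close>

lemma clique_le_chromatic_number:
  assumes "\<exists>k c. proper_coloring G k c" and "Q \<subseteq> pverts G"
    and "\<And>u v. u \<in> Q \<Longrightarrow> v \<in> Q \<Longrightarrow> u \<noteq> v \<Longrightarrow> (u, v) \<in> parcs G"
  shows "card Q \<le> chromatic_number G"
proof -
  obtain c where c: "proper_coloring G (chromatic_number G) c"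
    using LeastI_ex[OF assms(1)] unfolding chromatic_number_def by blast
  have "inj_on c Q" using c assms(3) unfolding proper_coloring_def by (fastforce intro: inj_onI)
  moreover have "c ` Q \<subseteq> {..<chromatic_number G}" using c assms(2) unfolding proper_coloring_def by auto
  ultimately show ?thesis using card_inj_on_le[of c Q "{..<chromatic_number G}"] by simp
qed

section \<open>Upper bound\<close>

context finite_field
begin

text \<open>The separation property of \<open>mrd_coloring\<close> in the shape in which
  \<open>low_rank_difference\<close> delivers a factorisation: the right factor consists of the
  difference rows indexed by \<open>S\<close>. Only columns outside \<open>P\<close> are compared,
  because in the application both matrices are the identity on \<open>P\<close>. The wording leaves
  open whether the syndrome is taken of a matrix or of its transpose.\<close>

definition rank_coloring :: "nat \<Rightarrow> nat set \<Rightarrow> nat \<Rightarrow> 'c set \<Rightarrow> ((nat \<Rightarrow> nat \<Rightarrow> 'a) \<Rightarrow> 'c) \<Rightarrow> bool" where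
  "rank_coloring n P d C col \<longleftrightarrow>
     (\<forall>A. (\<forall>i\<in>P. \<forall>l<n. A i l \<in> carrier K) \<longrightarrow> col A \<in> C) \<and>
     (\<forall>A B S x. (\<forall>i\<in>P. \<forall>l<n. A i l \<in> carrier K) \<longrightarrow> (\<forall>i\<in>P. \<forall>l<n. B i l \<in> carrier K) \<longrightarrow>
        S \<subseteq> P \<longrightarrow> card S \<le> d \<longrightarrow> (\<forall>i\<in>P. \<forall>s\<in>S. x i s \<in> carrier K) \<longrightarrow>
        (\<forall>i\<in>P. \<forall>l<n. A i l \<ominus> B i l = (\<Oplus>s\<in>S. x i s \<otimes> (A s l \<ominus> B s l))) \<longrightarrow> col A = col B \<longrightarrow>
        (\<forall>i\<in>P. \<forall>l\<in>{0..<n} - P. A i l = B i l))"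

text \<open>The long side of the matrices must index the basis of the extension field, so they are
  transposed when \<open>n - m < m\<close>.\<close>

lemma exists_rank_coloring:
  assumes q: "primepow (order K)" and P: "P \<subseteq> {0..<n}" "card P = m" and m: "m < n"
  shows "\<exists>(C :: (nat \<Rightarrow> ('a list \<times> nat) multiset \<Rightarrow> 'a) set) col. finite C \<and>
    card C = order K ^ (d * max (n - m) m) \<and> rank_coloring n P d C col"
proof -
  let ?Q = "{0..<n} - P"
  have finP: "finite P" using P finite_subset by blast
  have finQ: "finite ?Q" by simp
  have cQ: "card ?Q = n - m" using P finP by (simp add: card_Diff_subset)
  show ?thesis
  proof (cases "m \<le> n - m")
    case True
    have "card ?Q \<noteq> 0" using cQ m by linarith
    then have ne: "?Q \<noteq> {}" by (metis card.empty)
    have le: "card P \<le> card ?Q" using P cQ True by simp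
    show ?thesis
    proof (rule mrd_coloring[OF q refl finP finQ ne le, of d])
      fix C :: "(nat \<Rightarrow> ('a list \<times> nat) multiset \<Rightarrow> 'a) set" and col
      assume C: "finite C" "card C = order K ^ (card ?Q * d)"
        and col: "\<And>A. (\<And>i l. i \<in> P \<Longrightarrow> l \<in> ?Q \<Longrightarrow> A i l \<in> carrier K) \<Longrightarrow> col A \<in> C"
        and sep: "\<And>A B (S :: nat set) x y. \<lbrakk>\<And>i l. i \<in> P \<Longrightarrow> l \<in> ?Q \<Longrightarrow> A i l \<in> carrier K;
          \<And>i l. i \<in> P \<Longrightarrow> l \<in> ?Q \<Longrightarrow> B i l \<in> carrier K; finite S; card S \<le> d;
          \<And>i s. i \<in> P \<Longrightarrow> s \<in> S \<Longrightarrow> x i s \<in> carrier K; \<And>s l. s \<in> S \<Longrightarrow> l \<in> ?Q \<Longrightarrow> y s l \<in> carrier K;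
          \<And>i l. i \<in> P \<Longrightarrow> l \<in> ?Q \<Longrightarrow> A i l \<ominus> B i l = (\<Oplus>s\<in>S. x i s \<otimes> y s l); col A = col B\<rbrakk>
          \<Longrightarrow> \<forall>i\<in>P. \<forall>l\<in>?Q. A i l = B i l"
      have "rank_coloring n P d C col"
        unfolding rank_coloring_def
      proof (rule conjI; intro allI impI)
        fix A :: "nat \<Rightarrow> nat \<Rightarrow> 'a"
        assume "\<forall>i\<in>P. \<forall>l<n. A i l \<in> carrier K"
        then show "col A \<in> C" by (intro col) auto
      next
        fix A B :: "nat \<Rightarrow> nat \<Rightarrow> 'a" and S :: "nat set" and x
        assume *: "\<forall>i\<in>P. \<forall>l<n. A i l \<in> carrier K" "\<forall>i\<in>P. \<forall>l<n. B i l \<in> carrier K"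
          "S \<subseteq> P" "card S \<le> d" "\<forall>i\<in>P. \<forall>s\<in>S. x i s \<in> carrier K"
          "\<forall>i\<in>P. \<forall>l<n. A i l \<ominus> B i l = (\<Oplus>s\<in>S. x i s \<otimes> (A s l \<ominus> B s l))" "col A = col B"
        show "\<forall>i\<in>P. \<forall>l\<in>?Q. A i l = B i l"
        proof (rule sep[of A B S x "\<lambda>s l. A s l \<ominus> B s l"])
          show "finite S" using *(3) finP finite_subset by blast
          show "A s l \<ominus> B s l \<in> carrier K" if "s \<in> S" "l \<in> ?Q" for s l
            using that *(1-3) by auto
        qed (use * in auto)
      qed
      then show ?thesis using C cQ True by (auto simp: max_def mult.commute)
    qed
  next
    case False
    have ne: "P \<noteq> {}" using P False by auto
    have le: "card ?Q \<le> card P" using P cQ False by simp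
    show ?thesis
    proof (rule mrd_coloring[OF q refl finQ finP ne le, of d])
      fix C :: "(nat \<Rightarrow> ('a list \<times> nat) multiset \<Rightarrow> 'a) set" and col
      assume C: "finite C" "card C = order K ^ (card P * d)"
        and col: "\<And>A. (\<And>i l. i \<in> ?Q \<Longrightarrow> l \<in> P \<Longrightarrow> A i l \<in> carrier K) \<Longrightarrow> col A \<in> C"
        and sep: "\<And>A B (S :: nat set) x y. \<lbrakk>\<And>i l. i \<in> ?Q \<Longrightarrow> l \<in> P \<Longrightarrow> A i l \<in> carrier K;
          \<And>i l. i \<in> ?Q \<Longrightarrow> l \<in> P \<Longrightarrow> B i l \<in> carrier K; finite S; card S \<le> d;
          \<And>i s. i \<in> ?Q \<Longrightarrow> s \<in> S \<Longrightarrow> x i s \<in> carrier K; \<And>s l. s \<in> S \<Longrightarrow> l \<in> P \<Longrightarrow> y s l \<in> carrier K;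
          \<And>i l. i \<in> ?Q \<Longrightarrow> l \<in> P \<Longrightarrow> A i l \<ominus> B i l = (\<Oplus>s\<in>S. x i s \<otimes> y s l); col A = col B\<rbrakk>
          \<Longrightarrow> \<forall>i\<in>?Q. \<forall>l\<in>P. A i l = B i l"
      have "rank_coloring n P d C (\<lambda>A. col (\<lambda>l i. A i l))"
        unfolding rank_coloring_def
      proof (rule conjI; intro allI impI)
        fix A :: "nat \<Rightarrow> nat \<Rightarrow> 'a"
        assume "\<forall>i\<in>P. \<forall>l<n. A i l \<in> carrier K"
        then show "col (\<lambda>l i. A i l) \<in> C" by (intro col) auto
      next
        fix A B :: "nat \<Rightarrow> nat \<Rightarrow> 'a" and S :: "nat set" and x
        assume *: "\<forall>i\<in>P. \<forall>l<n. A i l \<in> carrier K" "\<forall>i\<in>P. \<forall>l<n. B i l \<in> carrier K"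
          "S \<subseteq> P" "card S \<le> d" "\<forall>i\<in>P. \<forall>s\<in>S. x i s \<in> carrier K"
          "\<forall>i\<in>P. \<forall>l<n. A i l \<ominus> B i l = (\<Oplus>s\<in>S. x i s \<otimes> (A s l \<ominus> B s l))"
          "col (\<lambda>l i. A i l) = col (\<lambda>l i. B i l)"
        have SP: "s \<in> P" if "s \<in> S" for s using that *(3) by auto
        have "\<forall>l\<in>?Q. \<forall>i\<in>P. A i l = B i l"
        \<comment> \<open>Transposition exchanges the factors: the difference rows become the left
          factor and \<open>x\<close> the right one.\<close>
        proof (rule sep[of "\<lambda>l i. A i l" "\<lambda>l i. B i l" S "\<lambda>l s. A s l \<ominus> B s l" "\<lambda>s i. x i s"])
          show "finite S" using *(3) finP finite_subset by blast
          show "A s l \<ominus> B s l \<in> carrier K" if "l \<in> ?Q" "s \<in> S" for s l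
            using that *(1,2) SP by auto
          show "A i l \<ominus> B i l = (\<Oplus>s\<in>S. (A s l \<ominus> B s l) \<otimes> x i s)" if "l \<in> ?Q" "i \<in> P" for i l
          proof -
            have "A i l \<ominus> B i l = (\<Oplus>s\<in>S. x i s \<otimes> (A s l \<ominus> B s l))" using that *(6) by auto
            also have "\<dots> = (\<Oplus>s\<in>S. (A s l \<ominus> B s l) \<otimes> x i s)"
              using that *(1,2,5) SP by (intro finsum_cong') (auto simp: m_comm)
            finally show ?thesis .
          qed
        qed (use * in auto)
        then show "\<forall>i\<in>P. \<forall>l\<in>?Q. A i l = B i l" by blast
      qed
      then show ?thesis using C P False by (auto simp: max_def mult.commute)
    qed
  qed
qed

lemma J_graph_simps:
  "pverts (J_graph K n m t) = subspaces_of_dim K n m"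
  "parcs (J_graph K n m t) = {(U, W). U \<in> subspaces_of_dim K n m \<and> W \<in> subspaces_of_dim K n m \<and>
     U \<noteq> W \<and> t \<le> subspace_dim K n (U \<inter> W)}"
  by (simp_all add: J_graph_def)

lemma chromatic_number_J_graph_upper:
  assumes q: "primepow (order K)" and m: "m < n"
  shows "\<exists>k c. proper_coloring (J_graph K n m t) k c"
    "chromatic_number (J_graph K n m t) \<le> 2 ^ n * order K ^ ((m - t) * max (n - m) m)"
proof -
  let ?V = "subspaces_of_dim K n m" and ?E = "order K ^ ((m - t) * max (n - m) m)"
  define det where "det U P \<longleftrightarrow> (\<forall>v\<in>U. (\<forall>i\<in>P. v i = \<zero>) \<longrightarrow> v = (\<lambda>i\<in>{0..<n}. \<zero>))"
    for U :: "(nat \<Rightarrow> 'a) set" and P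
  have sub: "subspace K U (coord_space K n)" "subspace_dim K n U = m" if "U \<in> ?V" for U
    using that by (auto simp: subspaces_of_dim_def)
  have "\<exists>P u. P \<subseteq> {0..<n} \<and> card P = m \<and> unit_system U P u \<and> det U P" if U: "U \<in> ?V" for U
  proof -
    have "v = (\<lambda>i\<in>{0..<n}. \<zero>)" if "v \<in> U" "\<forall>i\<in>{0..<n}. v i = \<zero>" for v
      using subspaceD(1)[OF sub(1)[OF U] that(1)] that(2) by (intro PiE_ext) auto
    then show ?thesis
      by (rule exists_information_set[OF sub(1)[OF U] _ subset_refl]) (use sub(2)[OF U] in \<open>auto simp: det_def\<close>)
  qed
  \<comment> \<open>A subspace can have several information sets; the choice is arbitrary, since two
    vertices of the same colour are forced to have made the same one.\<close>
  then obtain P u where Pu: "\<And>U. U \<in> ?V \<Longrightarrow> P U \<subseteq> {0..<n} \<and> card (P U) = m \<and> unit_system U (P U) (u U) \<and> det U (P U)"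
    by metis
  define \<P> where "\<P> = {P. P \<subseteq> {0..<n} \<and> card P = m}"
  have "\<forall>P\<in>\<P>. \<exists>(C :: (nat \<Rightarrow> ('a list \<times> nat) multiset \<Rightarrow> 'a) set) col.
      finite C \<and> card C = ?E \<and> rank_coloring n P (m - t) C col"
    unfolding \<P>_def using exists_rank_coloring[OF q _ _ m] by blast
  then obtain C :: "nat set \<Rightarrow> (nat \<Rightarrow> ('a list \<times> nat) multiset \<Rightarrow> 'a) set" and col
    where Ccol: "\<And>P. P \<in> \<P> \<Longrightarrow> finite (C P) \<and> card (C P) = ?E \<and> rank_coloring n P (m - t) (C P) (col P)"
    by metis
  define f where "f U = (P U, col (P U) (u U))" for U
  have fin\<P>: "finite \<P>" unfolding \<P>_def by simp
  have finC: "finite (C P)" "card (C P) = ?E" if "P \<in> \<P>" for P using Ccol[OF that] by auto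
  have uK: "u U i l \<in> carrier K" if "U \<in> ?V" "i \<in> P U" "l < n" for U i l
    using Pu[OF that(1)] subspaceD(5)[OF sub(1)[OF that(1)] _ that(3)] that(2) by (auto simp: unit_system_def)
  have fC: "f \<in> ?V \<rightarrow> Sigma \<P> C"
  proof
    fix U assume U: "U \<in> ?V"
    have PU: "P U \<subseteq> {0..<n}" "card (P U) = m" using Pu[OF U] by auto
    then have "rank_coloring n (P U) (m - t) (C (P U)) (col (P U))" using Ccol[of "P U"] by (simp add: \<P>_def)
    then have "col (P U) (u U) \<in> C (P U)" using uK[OF U] unfolding rank_coloring_def by blast
    then show "f U \<in> Sigma \<P> C" using PU by (simp add: f_def \<P>_def)
  qed
  have proper: "f U \<noteq> f W" if "(U, W) \<in> parcs (J_graph K n m t)" for U W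
  proof
    assume eq: "f U = f W"
    have U: "U \<in> ?V" and W: "W \<in> ?V" and ne: "U \<noteq> W" and t: "t \<le> subspace_dim K n (U \<inter> W)"
      using that by (auto simp: J_graph_simps)
    define R where "R = P U"
    have PW: "P W = R" and coleq: "col R (u U) = col R (u W)" using eq by (auto simp: f_def R_def)
    have R: "R \<subseteq> {0..<n}" "card R = m" and uU: "unit_system U R (u U)" and "det U R"
      using Pu[OF U] by (auto simp: R_def)
    have uW: "unit_system W R (u W)" and "det W R" using Pu[OF W] by (auto simp: PW)
    have detU: "v = (\<lambda>i\<in>{0..<n}. \<zero>)" if "v \<in> U" "\<forall>i\<in>R. v i = \<zero>" for v
      using that \<open>det U R\<close> by (simp add: det_def)
    have detW: "v = (\<lambda>i\<in>{0..<n}. \<zero>)" if "v \<in> W" "\<forall>i\<in>R. v i = \<zero>" for v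
      using that \<open>det W R\<close> by (simp add: det_def)
    obtain S x where S: "S \<subseteq> R" "card S = card R - t"
      and x: "\<And>i s. i \<in> R \<Longrightarrow> s \<in> S \<Longrightarrow> x i s \<in> carrier K"
      and fact: "\<And>i l. i \<in> R \<Longrightarrow> l < n \<Longrightarrow> u U i l \<ominus> u W i l = (\<Oplus>s\<in>S. x i s \<otimes> (u U s l \<ominus> u W s l))"
      using low_rank_difference[OF sub(1)[OF U] sub(1)[OF W] R(1) detU detW uU uW t] by blast
    have KU: "\<forall>i\<in>R. \<forall>l<n. u U i l \<in> carrier K" using uK[OF U] by (simp add: R_def)
    have KW: "\<forall>i\<in>R. \<forall>l<n. u W i l \<in> carrier K" using uK[OF W] by (simp add: PW)
    have out: "\<forall>i\<in>R. \<forall>l\<in>{0..<n} - R. u U i l = u W i l"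
    proof -
      have "rank_coloring n R (m - t) (C R) (col R)" using Ccol[of R] R by (simp add: \<P>_def)
      moreover have "card S \<le> m - t" using S R by simp
      moreover have "\<forall>i\<in>R. \<forall>l<n. u U i l \<ominus> u W i l = (\<Oplus>s\<in>S. x i s \<otimes> (u U s l \<ominus> u W s l))"
        using fact by blast
      moreover have "\<forall>i\<in>R. \<forall>s\<in>S. x i s \<in> carrier K" using x by blast
      ultimately show ?thesis using KU KW S(1) coleq unfolding rank_coloring_def by blast
    qed
    have same: "u U i l = u W i l" if "i \<in> R" "l < n" for i l
    proof (cases "l \<in> R")
      case True
      then show ?thesis using uU uW that by (simp add: unit_system_def)
    qed (use out that in auto)
    \<comment> \<open>Each vector is the combination of the unit system with its own coordinates on
      \<open>R\<close>, so equal systems span equal subspaces. The inclusion is stated generically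
      to serve both directions.\<close>
    have half: "U' \<subseteq> W'" if U': "U' \<in> ?V" and W': "W' \<in> ?V" and u': "unit_system U' R a" "unit_system W' R b"
      and d': "\<And>v. v \<in> U' \<Longrightarrow> \<forall>i\<in>R. v i = \<zero> \<Longrightarrow> v = (\<lambda>i\<in>{0..<n}. \<zero>)"
      and ab: "\<And>i l. i \<in> R \<Longrightarrow> l < n \<Longrightarrow> a i l = b i l" for U' W' a b
    proof
      fix v assume v: "v \<in> U'"
      have finR: "finite R" using R finite_subset by blast
      have vK: "v i \<in> carrier K" if "i \<in> R" for i using subspaceD(5)[OF sub(1)[OF U'] v] that R by auto
      have bK: "b i l \<in> carrier K" if "i \<in> R" "l < n" for i l
        using subspaceD(5)[OF sub(1)[OF W']] u'(2) that by (auto simp: unit_system_def)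
      have "v = (\<lambda>l\<in>{0..<n}. \<Oplus>i\<in>R. v i \<otimes> a i l)"
        by (rule unit_system_expansion[OF sub(1)[OF U'] d' R(1) u'(1) v])
      also have "\<dots> = (\<lambda>l\<in>{0..<n}. \<Oplus>i\<in>R. v i \<otimes> b i l)"
        using vK bK ab by (intro restrict_ext finsum_cong') auto
      also have "\<dots> \<in> W'"
        using vK u'(2) by (intro subspace_comb[OF sub(1)[OF W'] finR]) (auto simp: unit_system_def)
      finally show "v \<in> W'" .
    qed
    have "U = W"
      using half[OF U W uU uW detU same] half[OF W U uW uU detW same[symmetric]] by blast
    then show False using ne by simp
  qed
  have finS: "finite (Sigma \<P> C)" using fin\<P> finC by auto
  note col_bound = chromatic_number_le_card[of "Sigma \<P> C" f "J_graph K n m t", OF finS _ _ proper]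
  have c1: "\<exists>c. proper_coloring (J_graph K n m t) (card (Sigma \<P> C)) c"
    by (rule col_bound(1)) (use fC in \<open>auto simp: J_graph_simps\<close>)
  have c2: "chromatic_number (J_graph K n m t) \<le> card (Sigma \<P> C)"
    by (rule col_bound(2)) (use fC in \<open>auto simp: J_graph_simps\<close>)
  show "\<exists>k c. proper_coloring (J_graph K n m t) k c" using c1 by blast
  have "card (Sigma \<P> C) = card \<P> * ?E"
    using fin\<P> finC by simp
  \<comment> \<open>The coordinate sets are counted crudely; any bound independent of
    \<open>q\<close> would do.\<close>
  also have "card \<P> \<le> card (Pow {0..<n})" unfolding \<P>_def by (intro card_mono) auto
  then have "card \<P> * ?E \<le> 2 ^ n * ?E" by (simp add: card_Pow)
  finally show "chromatic_number (J_graph K n m t) \<le> 2 ^ n * ?E" using c2 by simp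
qed

end

section \<open>Lower bound\<close>

context finite_field
begin

text \<open>The row space of \<open>[I | A]\<close>, that is, the graph of
  \<open>v \<mapsto> v A\<close> over the first \<open>m\<close> coordinates.\<close>

definition graph_space :: "nat \<Rightarrow> nat \<Rightarrow> (nat \<Rightarrow> nat \<Rightarrow> 'a) \<Rightarrow> (nat \<Rightarrow> 'a) set" where
  "graph_space n m A =
     {v \<in> {0..<n} \<rightarrow>\<^sub>E carrier K. \<forall>l\<in>{m..<n}. v l = (\<Oplus>i\<in>{0..<m}. v i \<otimes> A i l)}"

context
  fixes n m :: nat and A :: "nat \<Rightarrow> nat \<Rightarrow> 'a"
  assumes mn: "m \<le> n" and A: "\<And>i l. i < m \<Longrightarrow> l \<in> {m..<n} \<Longrightarrow> A i l \<in> carrier K"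
begin

lemma subspace_graph_space: "subspace K (graph_space n m A) (coord_space K n)"
  unfolding subspace_iff
proof (intro conjI ballI)
  show "graph_space n m A \<subseteq> {0..<n} \<rightarrow>\<^sub>E carrier K" by (auto simp: graph_space_def)
  have "(\<Oplus>i\<in>{0..<m}. (\<lambda>i\<in>{0..<n}. \<zero>) i \<otimes> A i l) = \<zero>" if "l \<in> {m..<n}" for l
    using A that mn by (intro add.finprod_one_eqI) auto
  then show "(\<lambda>i\<in>{0..<n}. \<zero>) \<in> graph_space n m A" by (auto simp: graph_space_def)
next
  fix v w assume v: "v \<in> graph_space n m A" and w: "w \<in> graph_space n m A"
  have vK: "v i \<in> carrier K" and wK: "w i \<in> carrier K" if "i < n" for i
    using that v w PiE_mem[of _ "{0..<n}" "\<lambda>_. carrier K" i] by (auto simp: graph_space_def)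
  have "(\<Oplus>i\<in>{0..<m}. (\<lambda>i\<in>{0..<n}. v i \<oplus> w i) i \<otimes> A i l) = v l \<oplus> w l" if l: "l \<in> {m..<n}" for l
  proof -
    have "(\<Oplus>i\<in>{0..<m}. (\<lambda>i\<in>{0..<n}. v i \<oplus> w i) i \<otimes> A i l) = (\<Oplus>i\<in>{0..<m}. v i \<otimes> A i l \<oplus> w i \<otimes> A i l)"
      using vK wK A l mn by (intro finsum_cong') (auto simp: l_distr)
    also have "\<dots> = (\<Oplus>i\<in>{0..<m}. v i \<otimes> A i l) \<oplus> (\<Oplus>i\<in>{0..<m}. w i \<otimes> A i l)"
      using vK wK A l mn by (intro finsum_addf) auto
    also have "\<dots> = v l \<oplus> w l" using v w l by (simp add: graph_space_def)
    finally show ?thesis .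
  qed
  then show "(\<lambda>i\<in>{0..<n}. v i \<oplus> w i) \<in> graph_space n m A"
    using vK wK by (auto simp: graph_space_def)
next
  fix c v assume c: "c \<in> carrier K" and v: "v \<in> graph_space n m A"
  have vK: "v i \<in> carrier K" if "i < n" for i
    using that v PiE_mem[of _ "{0..<n}" "\<lambda>_. carrier K" i] by (auto simp: graph_space_def)
  have "(\<Oplus>i\<in>{0..<m}. (\<lambda>i\<in>{0..<n}. c \<otimes> v i) i \<otimes> A i l) = c \<otimes> v l" if l: "l \<in> {m..<n}" for l
  proof -
    have "c \<otimes> v l = c \<otimes> (\<Oplus>i\<in>{0..<m}. v i \<otimes> A i l)" using v l by (simp add: graph_space_def)
    also have "\<dots> = (\<Oplus>i\<in>{0..<m}. c \<otimes> (v i \<otimes> A i l))"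
      using c vK A l mn by (intro finsum_rdistr) auto
    also have "\<dots> = (\<Oplus>i\<in>{0..<m}. (\<lambda>i\<in>{0..<n}. c \<otimes> v i) i \<otimes> A i l)"
      using c vK A l mn by (intro finsum_cong') (auto simp: m_assoc)
    finally show ?thesis ..
  qed
  then show "(\<lambda>i\<in>{0..<n}. c \<otimes> v i) \<in> graph_space n m A"
    using c vK by (auto simp: graph_space_def)
qed

lemma graph_space_extend:
  assumes a: "\<And>i. i < m \<Longrightarrow> a i \<in> carrier K"
  shows "(\<lambda>l\<in>{0..<n}. if l < m then a l else (\<Oplus>i\<in>{0..<m}. a i \<otimes> A i l)) \<in> graph_space n m A"
    (is "?v \<in> _")
proof -
  have "?v l = (\<Oplus>i\<in>{0..<m}. ?v i \<otimes> A i l)" if l: "l \<in> {m..<n}" for l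
  proof -
    have "?v l = (\<Oplus>i\<in>{0..<m}. a i \<otimes> A i l)" using l by auto
    also have "\<dots> = (\<Oplus>i\<in>{0..<m}. ?v i \<otimes> A i l)"
      using a A l mn by (intro finsum_cong') auto
    finally show ?thesis .
  qed
  moreover have "?v \<in> {0..<n} \<rightarrow>\<^sub>E carrier K"
    using a A by (auto intro!: finsum_closed)
  ultimately show ?thesis unfolding graph_space_def by blast
qed

lemma card_graph_space: "card (graph_space n m A) = order K ^ m"
proof -
  have "bij_betw (\<lambda>v. restrict v {0..<m}) (graph_space n m A) ({0..<m} \<rightarrow>\<^sub>E carrier K)"
    unfolding bij_betw_def
  proof
    show "inj_on (\<lambda>v. restrict v {0..<m}) (graph_space n m A)"
    proof (rule inj_onI)
      fix v w assume v: "v \<in> graph_space n m A" and w: "w \<in> graph_space n m A"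
        and eq: "restrict v {0..<m} = restrict w {0..<m}"
      have same: "v i = w i" if "i < m" for i using fun_cong[OF eq, of i] that by simp
      have wK: "w i \<in> carrier K" if "i < n" for i
        using that w PiE_mem[of _ "{0..<n}" "\<lambda>_. carrier K" i] by (auto simp: graph_space_def)
      show "v = w"
      proof (rule PiE_ext)
        show "v \<in> {0..<n} \<rightarrow>\<^sub>E carrier K" "w \<in> {0..<n} \<rightarrow>\<^sub>E carrier K"
          using v w by (auto simp: graph_space_def)
        fix l assume l: "l \<in> {0..<n}"
        show "v l = w l"
        proof (cases "l < m")
          case False
          then have l': "l \<in> {m..<n}" using l by auto
          have "v l = (\<Oplus>i\<in>{0..<m}. v i \<otimes> A i l)" using v l' by (auto simp: graph_space_def)
          also have "\<dots> = (\<Oplus>i\<in>{0..<m}. w i \<otimes> A i l)"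
            using same wK A l' mn by (intro finsum_cong') auto
          also have "\<dots> = w l" using w l' by (auto simp: graph_space_def)
          finally show ?thesis .
        qed (rule same)
      qed
    qed
    show "(\<lambda>v. restrict v {0..<m}) ` graph_space n m A = {0..<m} \<rightarrow>\<^sub>E carrier K"
    proof (intro equalityI subsetI)
      fix a assume "a \<in> (\<lambda>v. restrict v {0..<m}) ` graph_space n m A"
      then obtain v where v: "v \<in> graph_space n m A" and a: "a = restrict v {0..<m}" by auto
      have "v i \<in> carrier K" if "i < m" for i
        using that v mn PiE_mem[of _ "{0..<n}" "\<lambda>_. carrier K" i] by (auto simp: graph_space_def)
      then show "a \<in> {0..<m} \<rightarrow>\<^sub>E carrier K" unfolding a by auto
    next
      fix a assume a: "a \<in> {0..<m} \<rightarrow>\<^sub>E carrier K"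
      let ?v = "\<lambda>l\<in>{0..<n}. if l < m then a l else (\<Oplus>i\<in>{0..<m}. a i \<otimes> A i l)"
      have v: "?v \<in> graph_space n m A"
        by (rule graph_space_extend) (use PiE_mem[OF a] in auto)
      have "restrict ?v {0..<m} = a"
        using a mn by (intro PiE_ext[of _ "{0..<m}" "\<lambda>_. carrier K"]) (auto dest: PiE_mem)
      then show "a \<in> (\<lambda>v. restrict v {0..<m}) ` graph_space n m A"
        using imageI[OF v, of "\<lambda>v. restrict v {0..<m}"] by simp
    qed
  qed
  then have "card (graph_space n m A) = card ({0..<m} \<rightarrow>\<^sub>E carrier K)" by (rule bij_betw_same_card)
  then show ?thesis by (simp add: card_PiE order_def)
qed

lemma graph_space_in_subspaces_of_dim: "graph_space n m A \<in> subspaces_of_dim K n m"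
  unfolding subspaces_of_dim_def
  using subspace_graph_space subspace_dim_eqI[OF subspace_graph_space card_graph_space] by simp

end

text \<open>The vector of the graph over the \<open>i\<close>-th unit vector carries row
  \<open>i\<close> of the matrix in its last coordinates.\<close>

lemma graph_space_inject:
  assumes mn: "m \<le> n" and A: "\<And>i l. i < m \<Longrightarrow> l \<in> {m..<n} \<Longrightarrow> A i l \<in> carrier K"
    and B: "\<And>i l. i < m \<Longrightarrow> l \<in> {m..<n} \<Longrightarrow> B i l \<in> carrier K"
    and eq: "graph_space n m A = graph_space n m B" and i: "i < m" and l: "l \<in> {m..<n}"
  shows "A i l = B i l"
proof -
  let ?e = "\<lambda>j. if i = j then \<one> else \<zero>"
  let ?v = "\<lambda>l\<in>{0..<n}. if l < m then ?e l else (\<Oplus>j\<in>{0..<m}. ?e j \<otimes> A j l)"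
  have sing: "(\<Oplus>j\<in>{0..<m}. ?e j \<otimes> M j l) = M i l" if M: "\<And>j. j < m \<Longrightarrow> M j l \<in> carrier K" for M
  proof -
    have "(\<Oplus>j\<in>{0..<m}. ?e j \<otimes> M j l) = (\<Oplus>j\<in>{0..<m}. if i = j then M j l else \<zero>)"
      using M by (intro finsum_cong') auto
    also have "\<dots> = M i l" using i M by (intro finsum_singleton) auto
    finally show ?thesis .
  qed
  have "?v \<in> graph_space n m B"
    unfolding eq[symmetric] by (rule graph_space_extend[OF mn A]) auto
  then have "?v l = (\<Oplus>j\<in>{0..<m}. ?v j \<otimes> B j l)" using l unfolding graph_space_def by blast
  also have "\<dots> = (\<Oplus>j\<in>{0..<m}. ?e j \<otimes> B j l)"
    using B l mn by (intro finsum_cong') auto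
  also have "\<dots> = B i l" using B l by (intro sing) auto
  finally show ?thesis using l sing[of A] A by auto
qed

text \<open>The difference map from \<open>U \<times> W\<close> to \<open>T\<close> has fibres no
  larger than \<open>U \<inter> W\<close>. This is the dimension formula in multiplicative form,
  obtained without forming \<open>U + W\<close>.\<close>

lemma card_Int_ge:
  assumes U: "subspace K U (coord_space K n)" and W: "subspace K W (coord_space K n)"
    and T: "subspace K T (coord_space K n)" and sub: "U \<subseteq> T" "W \<subseteq> T"
  shows "card U * card W \<le> card T * card (U \<inter> W)"
proof -
  let ?d = "\<lambda>v w. \<lambda>i\<in>{0..<n}. v i \<ominus> w i"
  let ?fib = "\<lambda>x. {p \<in> U \<times> W. ?d (fst p) (snd p) = x}"
  have fin: "finite U" "finite W" "finite T" using finite_subspace U W T by auto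
  have cancel: "v = w" if "v \<in> U \<union> W" "w \<in> U \<union> W" "?d v u = ?d w u" "u \<in> U \<union> W" for v w u
  proof (rule PiE_ext)
    have T': "v \<in> T" "w \<in> T" "u \<in> T" using that sub by auto
    show "v \<in> {0..<n} \<rightarrow>\<^sub>E carrier K" "w \<in> {0..<n} \<rightarrow>\<^sub>E carrier K" using T' subspaceD(1)[OF T] by auto
    fix i assume i: "i \<in> {0..<n}"
    then have "v i \<ominus> u i = w i \<ominus> u i" using fun_cong[OF that(3), of i] by simp
    then show "v i = w i" using i T' subspaceD(5)[OF T] by (simp add: a_minus_def)
  qed
  have fib: "card (?fib x) \<le> card (U \<inter> W)" for x
  proof (cases "?fib x = {}")
    case True
    then show ?thesis by (simp only: card.empty)
  next
    case False
    then obtain u0 w0 where p0: "u0 \<in> U" "w0 \<in> W" "?d u0 w0 = x" by auto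
    \<comment> \<open>Relative to a fixed pair \<open>(u0, w0)\<close> of the fibre,
      \<open>u - u0 = w - w0\<close> lies in both \<open>U\<close> and \<open>W\<close>; this maps
      the fibre injectively into the intersection.\<close>
    have shift: "?d u u0 = ?d w w0" if "u \<in> U" "w \<in> W" "?d u w = x" for u w
    proof (rule restrict_ext)
      fix i assume i: "i \<in> {0..<n}"
      have K: "u i \<in> carrier K" "u0 i \<in> carrier K" "w i \<in> carrier K" "w0 i \<in> carrier K"
        using i that p0 subspaceD(5)[OF U] subspaceD(5)[OF W] by auto
      have eq: "u i \<ominus> w i = u0 i \<ominus> w0 i"
        using fun_cong[OF trans[OF that(3) p0(3)[symmetric]], of i] i by simp
      have "u i = (u i \<ominus> w i) \<oplus> w i" using K by (simp add: a_minus_def a_assoc l_neg)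
      then have "u i = u0 i \<oplus> (w i \<ominus> w0 i)" unfolding eq using K by (simp add: a_minus_def a_ac)
      then show "u i \<ominus> u0 i = w i \<ominus> w0 i" using K by (intro minus_eqI) (auto simp: a_comm)
    qed
    show ?thesis
    proof (rule card_inj_on_le[of "\<lambda>p. ?d (fst p) u0"])
      show "inj_on (\<lambda>p. ?d (fst p) u0) (?fib x)"
      proof (rule inj_onI)
        fix p p' assume p: "p \<in> ?fib x" and p': "p' \<in> ?fib x" and eq: "?d (fst p) u0 = ?d (fst p') u0"
        have m: "fst p \<in> U" "snd p \<in> W" "?d (fst p) (snd p) = x" using p by auto
        have m': "fst p' \<in> U" "snd p' \<in> W" "?d (fst p') (snd p') = x" using p' by auto
        have 1: "fst p = fst p'" by (rule cancel[OF _ _ eq]) (simp_all only: m m' p0 Un_iff simp_thms)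
        have "?d (snd p) w0 = ?d (snd p') w0"
          using eq unfolding shift[OF m] shift[OF m'] .
        then have "snd p = snd p'"
          by (rule cancel[rotated 2]) (simp_all only: m m' p0 Un_iff simp_thms)
        with 1 show "p = p'" by (rule prod_eqI)
      qed
      show "(\<lambda>p. ?d (fst p) u0) ` ?fib x \<subseteq> U \<inter> W"
      proof
        fix z assume "z \<in> (\<lambda>p. ?d (fst p) u0) ` ?fib x"
        then obtain u w where uw: "u \<in> U" "w \<in> W" "?d u w = x" "z = ?d u u0" by auto
        have "z \<in> U" unfolding uw(4) by (rule subspace_minus[OF U uw(1) p0(1)])
        moreover have "z \<in> W" unfolding uw(4) shift[OF uw(1-3)] by (rule subspace_minus[OF W uw(2) p0(2)])
        ultimately show "z \<in> U \<inter> W" by simp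
      qed
    qed (use fin in simp)
  qed
  have "U \<times> W \<subseteq> (\<Union>x\<in>T. ?fib x)"
  proof
    fix p assume p: "p \<in> U \<times> W"
    then have "fst p \<in> T" "snd p \<in> T" using sub by auto
    from subspace_minus[OF T this] p show "p \<in> (\<Union>x\<in>T. ?fib x)" by blast
  qed
  then have "card (U \<times> W) \<le> card (\<Union>x\<in>T. ?fib x)"
    using fin by (intro card_mono finite_UN_I) auto
  also have "\<dots> \<le> (\<Sum>x\<in>T. card (?fib x))" using fin by (intro card_UN_le) auto
  also have "\<dots> \<le> card T * card (U \<inter> W)" using fib by (intro sum_bounded_above[where K = "card (U \<inter> W)", simplified]) auto
  finally show ?thesis by (simp add: card_cartesian_product)
qed

text \<open>Matrices supported on \<open>I \<times> J\<close> give
  \<open>q ^ (card I * card J)\<close> distinct vertices, and \<open>inter\<close> makes them a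
  clique. Leaving the support open lets both cliques be instances: some rows with all columns, or
  all rows with some columns.\<close>

lemma chromatic_number_J_graph_ge_clique:
  assumes col: "\<exists>k c. proper_coloring (J_graph K n m t) k c" and mn: "m \<le> n"
    and IJ: "I \<subseteq> {0..<m}" "J \<subseteq> {m..<n}"
    and inter: "\<And>A B. \<lbrakk>\<And>i l. A i l \<in> carrier K; \<And>i l. B i l \<in> carrier K;
        \<And>i l. i \<notin> I \<or> l \<notin> J \<Longrightarrow> A i l = \<zero>; \<And>i l. i \<notin> I \<or> l \<notin> J \<Longrightarrow> B i l = \<zero>\<rbrakk> \<Longrightarrow>
        t \<le> subspace_dim K n (graph_space n m A \<inter> graph_space n m B)"
  shows "order K ^ (card I * card J) \<le> chromatic_number (J_graph K n m t)"
proof -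
  let ?M = "(I \<times> J) \<rightarrow>\<^sub>E carrier K"
  define ext where "ext a i l = (if i \<in> I \<and> l \<in> J then a (i, l) else \<zero>)" for a :: "nat \<times> nat \<Rightarrow> 'a" and i l
  have extK: "ext a i l \<in> carrier K" if "a \<in> ?M" for a i l
    using that by (auto simp: ext_def dest: PiE_mem)
  let ?Q = "(\<lambda>a. graph_space n m (ext a)) ` ?M"
  have fin: "finite I" "finite J" using IJ finite_subset by blast+
  have "inj_on (\<lambda>a. graph_space n m (ext a)) ?M"
  proof (rule inj_onI)
    fix a b assume a: "a \<in> ?M" and b: "b \<in> ?M" and eq: "graph_space n m (ext a) = graph_space n m (ext b)"
    show "a = b"
    proof (rule PiE_ext[OF a b])
      fix p assume p: "p \<in> I \<times> J"
      obtain i l where il: "p = (i, l)" "i \<in> I" "l \<in> J" using p by auto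
      have "ext a i l = ext b i l"
        using graph_space_inject[OF mn extK[OF a] extK[OF b] eq, of i l]
          subsetD[OF IJ(1) il(2)] subsetD[OF IJ(2) il(3)] by simp
      then show "a p = b p" using il by (simp add: ext_def)
    qed
  qed
  then have "card ?Q = card ?M" by (rule card_image)
  also have "\<dots> = order K ^ (card I * card J)"
    using fin by (simp add: card_PiE order_def card_cartesian_product)
  finally have cQ: "card ?Q = order K ^ (card I * card J)" .
  have vert: "graph_space n m (ext a) \<in> subspaces_of_dim K n m" if "a \<in> ?M" for a
    by (rule graph_space_in_subspaces_of_dim[OF mn extK[OF that]])
  have "card ?Q \<le> chromatic_number (J_graph K n m t)"
  proof (rule clique_le_chromatic_number[OF col])
    show "?Q \<subseteq> pverts (J_graph K n m t)" unfolding J_graph_simps using vert by auto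
    fix U W assume U: "U \<in> ?Q" and W: "W \<in> ?Q" and ne: "U \<noteq> W"
    then obtain a b where ab: "a \<in> ?M" "b \<in> ?M" "U = graph_space n m (ext a)" "W = graph_space n m (ext b)"
      by auto
    have "t \<le> subspace_dim K n (U \<inter> W)"
      unfolding ab by (rule inter) (use extK ab in \<open>auto simp: ext_def\<close>)
    then show "(U, W) \<in> parcs (J_graph K n m t)"
      unfolding J_graph_simps using vert ab ne by auto
  qed
  then show ?thesis using cQ by simp
qed

lemma chromatic_number_J_graph_lower:
  assumes col: "\<exists>k c. proper_coloring (J_graph K n m t) k c" and mn: "m \<le> n" and tm: "t \<le> m"
    and nd: "2 * m \<le> n + t"
  shows "order K ^ ((m - t) * max (n - m) m) \<le> chromatic_number (J_graph K n m t)"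
proof -
  \<comment> \<open>The graph of the zero map over \<open>k\<close> coordinates is the span of the
    first \<open>k\<close> unit vectors. Taking \<open>k = t\<close> gives the space common to the
    vertices of one clique, \<open>k = 2 * m - t\<close> the space containing those of the
    other.\<close>
  have zero: "subspace K (graph_space n k (\<lambda>_ _. \<zero>)) (coord_space K n)"
    "card (graph_space n k (\<lambda>_ _. \<zero>)) = order K ^ k" if "k \<le> n" for k
    using subspace_graph_space[OF that] card_graph_space[OF that] by auto
  have zero_iff: "v \<in> graph_space n k (\<lambda>_ _. \<zero>) \<longleftrightarrow> v \<in> {0..<n} \<rightarrow>\<^sub>E carrier K \<and> (\<forall>l\<in>{k..<n}. v l = \<zero>)"
    if "k \<le> n" for k v
  proof -
    have "(\<Oplus>i\<in>{0..<k}. v i \<otimes> \<zero>) = \<zero>" if "v \<in> {0..<n} \<rightarrow>\<^sub>E carrier K"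
      using PiE_mem[OF that] \<open>k \<le> n\<close> by (intro add.finprod_one_eqI) auto
    then show ?thesis by (auto simp: graph_space_def)
  qed
  have 1: "order K ^ (card {t..<m} * card {m..<n}) \<le> chromatic_number (J_graph K n m t)"
  proof (rule chromatic_number_J_graph_ge_clique[OF col mn])
    fix A B :: "nat \<Rightarrow> nat \<Rightarrow> 'a"
    assume A: "\<And>i l. A i l \<in> carrier K" and B: "\<And>i l. B i l \<in> carrier K"
      and A0: "\<And>i l. i \<notin> {t..<m} \<or> l \<notin> {m..<n} \<Longrightarrow> A i l = \<zero>"
      and B0: "\<And>i l. i \<notin> {t..<m} \<or> l \<notin> {m..<n} \<Longrightarrow> B i l = \<zero>"
    have tn: "t \<le> n" using tm mn by simp
    have incl: "graph_space n t (\<lambda>_ _. \<zero>) \<subseteq> graph_space n m M"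
      if M: "\<And>i l. M i l \<in> carrier K" and M0: "\<And>i l. i \<notin> {t..<m} \<or> l \<notin> {m..<n} \<Longrightarrow> M i l = \<zero>" for M
    proof
      fix v assume "v \<in> graph_space n t (\<lambda>_ _. \<zero>)"
      then have v: "v \<in> {0..<n} \<rightarrow>\<^sub>E carrier K" "\<forall>l\<in>{t..<n}. v l = \<zero>" using zero_iff[OF tn] by auto
      \<comment> \<open>Every term vanishes: \<open>M i l\<close> is zero for \<open>i < t\<close>,
        and \<open>v i\<close> is zero from \<open>t\<close> on.\<close>
      have "(\<Oplus>i\<in>{0..<m}. v i \<otimes> M i l) = \<zero>" for l
      proof (rule add.finprod_one_eqI)
        fix i assume i: "i \<in> {0..<m}"
        have "v i \<in> carrier K" using PiE_mem[OF v(1)] i mn by auto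
        then show "v i \<otimes> M i l = \<zero>" using v(2) M M0[of i l] i mn by (cases "i < t") auto
      qed
      then show "v \<in> graph_space n m M" using v tm by (auto simp: graph_space_def)
    qed
    have S: "subspace K (graph_space n m A \<inter> graph_space n m B) (coord_space K n)"
      using subspace_graph_space[OF mn] A B by (intro subspace_Int) auto
    show "t \<le> subspace_dim K n (graph_space n m A \<inter> graph_space n m B)"
    proof (rule subspace_dim_geI[OF S])
      have "order K ^ t = card (graph_space n t (\<lambda>_ _. \<zero>))" using zero(2)[OF tn] by simp
      also have "\<dots> \<le> card (graph_space n m A \<inter> graph_space n m B)"
        using incl[OF A A0] incl[OF B B0] finite_subspace[OF S] by (intro card_mono) auto
      finally show "order K ^ t \<le> card (graph_space n m A \<inter> graph_space n m B)" .
    qed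
  qed auto
  \<comment> \<open>There are \<open>m\<close> coordinates for the domain and \<open>m - t\<close>
    for the values. The hypothesis \<open>2 * m \<le> n + t\<close> amounts to
    \<open>?k \<le> n\<close>, and \<open>t \<le> m\<close> ensures
    \<open>m \<le> ?k\<close>.\<close>
  let ?k = "2 * m - t"
  have 2: "order K ^ (card {0..<m} * card {m..<?k}) \<le> chromatic_number (J_graph K n m t)"
  proof (rule chromatic_number_J_graph_ge_clique[OF col mn])
    have kn: "?k \<le> n" using nd by simp
    show "{m..<?k} \<subseteq> {m..<n}" using kn by auto
    fix A B :: "nat \<Rightarrow> nat \<Rightarrow> 'a"
    assume A: "\<And>i l. A i l \<in> carrier K" and B: "\<And>i l. B i l \<in> carrier K"
      and A0: "\<And>i l. i \<notin> {0..<m} \<or> l \<notin> {m..<?k} \<Longrightarrow> A i l = \<zero>"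
      and B0: "\<And>i l. i \<notin> {0..<m} \<or> l \<notin> {m..<?k} \<Longrightarrow> B i l = \<zero>"
    let ?U = "graph_space n m A" and ?W = "graph_space n m B" and ?X = "graph_space n ?k (\<lambda>_ _. \<zero>)"
    have incl: "graph_space n m M \<subseteq> ?X"
      if M: "\<And>i l. M i l \<in> carrier K" and M0: "\<And>i l. i \<notin> {0..<m} \<or> l \<notin> {m..<?k} \<Longrightarrow> M i l = \<zero>" for M
    proof
      fix v assume v: "v \<in> graph_space n m M"
      then have vE: "v \<in> {0..<n} \<rightarrow>\<^sub>E carrier K" by (simp add: graph_space_def)
      have "v l = \<zero>" if l: "l \<in> {?k..<n}" for l
      proof -
        have "v l = (\<Oplus>i\<in>{0..<m}. v i \<otimes> M i l)" using v l tm by (auto simp: graph_space_def)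
        also have "\<dots> = \<zero>"
          using PiE_mem[OF vE] M0 l mn by (intro add.finprod_one_eqI) auto
        finally show ?thesis .
      qed
      then show "v \<in> ?X" unfolding zero_iff[OF kn] using vE by blast
    qed
    have SU: "subspace K ?U (coord_space K n)" and SW: "subspace K ?W (coord_space K n)"
      using subspace_graph_space[OF mn] A B by auto
    have S: "subspace K (?U \<inter> ?W) (coord_space K n)" by (rule subspace_Int[OF SU SW])
    show "t \<le> subspace_dim K n (?U \<inter> ?W)"
    proof (rule subspace_dim_geI[OF S])
      have "card ?U * card ?W \<le> card ?X * card (?U \<inter> ?W)"
        by (rule card_Int_ge[OF SU SW zero(1)[OF kn] incl[OF A A0] incl[OF B B0]])
      \<comment> \<open>Cancelling \<open>q ^ (2 * m - t)\<close> leaves at least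
        \<open>q ^ t\<close> elements for the intersection.\<close>
      then have "order K ^ m * order K ^ m \<le> order K ^ ?k * card (?U \<inter> ?W)"
        using zero(2)[OF kn] card_graph_space[OF mn A] card_graph_space[OF mn B] by simp
      moreover have "order K ^ m * order K ^ m = order K ^ ?k * order K ^ t"
        using tm by (simp add: power_add[symmetric] mult_2)
      ultimately show "order K ^ t \<le> card (?U \<inter> ?W)" using order_ge_2 by simp
    qed
  qed auto
  have "m * (?k - m) = (m - t) * m" using tm by (simp add: mult.commute)
  then show ?thesis using 1 2 by (auto simp: max_def mult.commute)
qed

end

section \<open>Asymptotics along the prime powers\<close>

theorem mainTheorem3:
  fixes n m t :: nat
    and F :: "nat \<Rightarrow> 'a ring"
  assumes F: "\<And>q. primepow q \<Longrightarrow> field (F q) \<and> order (F q) = q"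
    and "m < n" and "1 \<le> t" and "t \<le> m - 1"
    and nondegenerate: "2 * m \<le> n + t"
  shows "(\<lambda>q. real (chromatic_number (J_graph (F q) n m t)))
           \<in> \<Theta>[inf at_top (principal {q. primepow q})](\<lambda>q. real q ^ ((m - t) * max (n - m) m))"
proof -
  let ?e = "(m - t) * max (n - m) m" and ?\<chi> = "\<lambda>q. chromatic_number (J_graph (F q) n m t)"
  \<comment> \<open>Both inequalities hold at every prime power, and their constants
    \<open>1\<close> and \<open>2 ^ n\<close> do not depend on \<open>q\<close>.\<close>
  have bounds: "q ^ ?e \<le> ?\<chi> q" "?\<chi> q \<le> 2 ^ n * q ^ ?e" if q: "primepow q" for q
  proof -
    have ord: "order (F q) = q" and fld: "field (F q)" using F[OF q] by auto
    \<comment> \<open>An infinite carrier would have order \<open>0\<close>.\<close>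
    have fin: "finite (carrier (F q))"
      using ord primepow_gt_0_nat[OF q] by (auto simp: order_def intro: card_ge_0_finite)
    interpret finite_field "F q"
      using fld fin by (simp add: finite_field_def finite_field_axioms_def)
    note upper = chromatic_number_J_graph_upper[of m n t, unfolded ord, OF q \<open>m < n\<close>]
    show "?\<chi> q \<le> 2 ^ n * q ^ ?e" by (rule upper(2))
    show "q ^ ?e \<le> ?\<chi> q"
      using chromatic_number_J_graph_lower[OF upper(1)] assms(2-5) ord by simp
  qed
  have ev: "eventually (\<lambda>q. primepow q) (inf at_top (principal {q :: nat. primepow q}))"
    by (simp add: eventually_inf_principal)
  show ?thesis
  proof (rule bigthetaI)
    show "(\<lambda>q. real (?\<chi> q)) \<in> O[inf at_top (principal {q. primepow q})](\<lambda>q. real q ^ ?e)"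
    proof (rule bigoI[where c = "2 ^ n"], rule eventually_mono[OF ev])
      fix q :: nat assume "primepow q"
      from bounds(2)[OF this] have "real (?\<chi> q) \<le> real (2 ^ n * q ^ ?e)" by (rule of_nat_mono)
      then show "norm (real (?\<chi> q)) \<le> 2 ^ n * norm (real q ^ ?e)" by simp
    qed
    show "(\<lambda>q. real (?\<chi> q)) \<in> \<Omega>[inf at_top (principal {q. primepow q})](\<lambda>q. real q ^ ?e)"
    proof (rule landau_omega.bigI[where c = 1], simp, rule eventually_mono[OF ev])
      fix q :: nat assume "primepow q"
      from bounds(1)[OF this] have "real (q ^ ?e) \<le> real (?\<chi> q)" by (rule of_nat_mono)
      then show "1 * norm (real q ^ ?e) \<le> norm (real (?\<chi> q))" by simp
    qed
  qed
qed

end
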